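(* Under the standing setup below, there exist positive real numbers $r_0,\varepsilon_m,K$ and $\varepsilon_0$ (with $\varepsilon_0$ sufficiently small) such that, for every $\theta\in\mathbb R$, the following hold, where $j$ ranges over the (finitely many) integers with $U_j^\theta\neq\emptyset$ and $V_j^\theta:=B_{\varepsilon_m}(U_j^\theta)$: (PRE) the sets $U_j^\theta$ are pairwise disjoint open subsets of $\Omega$, $\overline{U_j^\theta}\subset V_j^\theta$, and $T_j^\theta:V_j^\theta\to\mathbb R^k$ is $C^2$; (PE1) $T_\theta|_{U_j^\theta}=T_j^\theta|_{U_j^\theta}$ and $B_{r_0}(T_\theta(U_j^\theta))\subset T_j^\theta(V_j^\theta)$; (PE2) $T_j^\theta$ is a $C^2$ diffeomorphism of $V_j^\theta$ onto its image, and for all $\varepsilon\in(0,\varepsilon_0)$, all $z\in T_j^\theta(V_j^\theta)$ and all $x,y\in B(z,\varepsilon)\cap T_j^\theta(V_j^\theta)$, $$\big|\det D(T_j^\theta)^{-1}(x)-\det D(T_j^\theta)^{-1}(y)\big|\le K\,\big|\det D(T_j^\theta)^{-1}(z)\big|\,\varepsilon;$$ (PE3) $m\big(\Omega\setminus\bigcup_j U_j^\theta\big)=0$; (PE4) for all $u,v\in T_j^\theta(V_j^\theta)$ with $d(u,v)\le\varepsilon_0$, $d\big((T_j^\theta)^{-1}(u),(T_j^\theta)^{-1}(v)\big)\le \sigma^{-1/2}d(u,v)$; (PE5) setting, for $x\in\mathbb R^k$ and $0<\varepsilon\le\delta$, $$G(x,\varepsilon,\delta)=\sum_j\frac{m\Big((T_j^\theta)^{-1}\big[B_\varepsilon(\partial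 T_j^\theta(U_j^\theta))\big]\cap B\big(x,(1-\sigma^{-1/2})\delta\big)\Big)}{m\Big(B\big(x,(1-\sigma^{-1/2})\delta\big)\Big)},\qquad G(\varepsilon,\delta)=\sup_{x}G(x,\varepsilon,\delta),$$ and $\eta(\delta)=\sigma^{-1/2}+2\sup_{\varepsilon\le\delta}\frac{G(\varepsilon,\delta)}{\varepsilon}\,\delta$, one has $\sup_{\delta\le\varepsilon_0}\eta(\delta)<1$.
   Context: Standing setup. Fix an integer $k\ge2$ and reals $L>0$, $\beta>0$. Let $\Phi_0:(-L-\beta,L+\beta)^k\to\mathbb R$ be $C^2$. For $n\ge1$ let $\gamma_n$ be the Lebesgue volume of the unit ball of $\mathbb R^n$. For $\sigma>1$, $Y>0$ put $\eta_0(\sigma,Y)=\sigma^{-1/2}+\frac{4}{\sqrt\sigma-1}\,Y\,\frac{\gamma_{k-1}}{\gamma_k}$ and let $S_k(Y)>1$ be the value of $\sigma$ with $\eta_0(\sigma,Y)=1$. Fix $\sigma>S_k(k+2)$ and constants $C_1,C_2>1$, and assume: $\gamma^{-2}=C_1\sigma$ (this defines $\gamma\in(0,1)$); for all $x\in(-L-\beta,L+\beta)^k$, $(\partial_1\Phi_0(x))^2\ge C_1^{k-1}C_2\sigma^k$ and $(\partial_j\Phi_0(x))^2\le\frac{(C_1-1)(C_2-1)}{k-1}\sigma$ for $2\le j\le k$. Let $\Gamma:\mathbb R^k\to\mathbb R^k$, $\Gamma(x)=(\gamma^{-(j-1)}x_j)_{j=1}^k$; $\Omega=\prod_{j=1}^k[-\gamma^{j-1}L,\gamma^{j-1}L]=\Gamma^{-1}([-L,L]^k)$;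 for $r\in[0,\beta]$, $\Omega_r=\Gamma^{-1}((-L-r,L+r)^k)$. For $\theta\in\mathbb R$, $j\in\mathbb Z$: $U_j^\theta=\{x\in\Omega_0:(2j-1)L<\theta+\Phi_0(\Gamma x)<(2j+1)L\}$ and $\Sigma_j^\theta=\{x\in\Omega:\theta+\Phi_0(\Gamma x)=(2j-1)L\}$. Define $S:\Omega_\beta\to\mathbb R^k$, $S(u)=(u_2/\gamma,\dots,u_k/\gamma,\gamma^{k-1}\Phi_0(\Gamma u))$, and $T_j^\theta(u)=S(u)+(0,\dots,0,\gamma^{k-1}(\theta-2jL))$. The map $T_\theta:\Omega\to\Omega$ is defined almost everywhere by $T_\theta=T_j^\theta$ on $U_j^\theta$ (equivalently $T_\theta(u)=(u_2/\gamma,\dots,u_k/\gamma,\gamma^{k-1}\varphi_\theta(\Gamma u))$ where $\varphi_\theta(x)=\Phi_0(x)+\theta$ reduced modulo $2L$ into $[-L,L]$). Notation: $m$ is Lebesgue measure, $d$ and $\|\cdot\|$ are Euclidean, $B(x,\varepsilon)$ is the open ball, and for $X\subset\mathbb R^k$, $B_\varepsilon(X)=\{x\in\mathbb R^k:d(x,X)<\varepsilon\}$. *)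

theory Defs
  imports "HOL-Analysis.Analysis"
begin

text \<open>R^k is modelled as real^'n with 'n a finite linearly ordered index type,
  k = CARD('n).  The paper's coordinate j (1-based) is the element of 'n at
  0-based position j-1 in the ordering.\<close>

definition pos :: "'n::{finite,linorder} \<Rightarrow> nat" where
  "pos i = card {j. j < i}"

definition crd :: "nat \<Rightarrow> 'n::{finite,linorder}" where
  "crd p = sorted_list_of_set (UNIV :: 'n set) ! p"

definition C2_on :: "'a::real_normed_vector set \<Rightarrow> ('a \<Rightarrow> 'b::real_normed_vector) \<Rightarrow> bool" where
  "C2_on S f \<longleftrightarrow> (\<exists>f' f''. (\<forall>x\<in>S. (f has_derivative blinfun_apply (f' x)) (at x)
      \<and> (f' has_derivative blinfun_apply (f'' x)) (at x)) \<and> continuous_on S f'')"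

definition C2_diffeo_on :: "'a::real_normed_vector set \<Rightarrow> ('a \<Rightarrow> 'a) \<Rightarrow> bool" where
  "C2_diffeo_on V f \<longleftrightarrow> open V \<and> C2_on V f \<and> inj_on f V \<and> open (f ` V)
      \<and> C2_on (f ` V) (inv_into V f)"

definition partial :: "(real^('n::{finite,linorder}) \<Rightarrow> real) \<Rightarrow> nat \<Rightarrow> real^('n::{finite,linorder}) \<Rightarrow> real" where
  "partial \<Phi> p x = frechet_derivative \<Phi> (at x) (axis (crd p) 1)"

definition jac_det :: "(real^'n \<Rightarrow> real^'n) \<Rightarrow> real^'n \<Rightarrow> real" where
  "jac_det g x = det (matrix (frechet_derivative g (at x)))"

definition nbhd :: "real \<Rightarrow> 'a::metric_space set \<Rightarrow> 'a set" where
  "nbhd \<epsilon> X = {x. \<exists>y\<in>X. dist x y < \<epsilon>}"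

definition eta0 :: "nat \<Rightarrow> real \<Rightarrow> real \<Rightarrow> real" where
  "eta0 k \<sigma> Y = \<sigma> powr (-1/2) + 4 / (sqrt \<sigma> - 1) * Y * (unit_ball_vol (real k - 1) / unit_ball_vol (real k))"

definition Sk :: "nat \<Rightarrow> real \<Rightarrow> real" where
  "Sk k Y = (THE s. s > 1 \<and> eta0 k s Y = 1)"

definition ocube :: "real \<Rightarrow> (real^'n) set" where
  "ocube r = {x. \<forall>i. \<bar>x $ i\<bar> < r}"

definition ccube :: "real \<Rightarrow> (real^'n) set" where
  "ccube r = {x. \<forall>i. \<bar>x $ i\<bar> \<le> r}"

definition Gam :: "real \<Rightarrow> real^('n::{finite,linorder}) \<Rightarrow> real^('n::{finite,linorder})" where
  "Gam \<gamma> x = (\<chi> i. x $ i / \<gamma> ^ pos i)"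

definition Omega :: "real \<Rightarrow> real \<Rightarrow> (real^('n::{finite,linorder})) set" where
  "Omega \<gamma> L = {x. Gam \<gamma> x \<in> ccube L}"

definition Omega_r :: "real \<Rightarrow> real \<Rightarrow> real \<Rightarrow> (real^('n::{finite,linorder})) set" where
  "Omega_r \<gamma> L r = {x. Gam \<gamma> x \<in> ocube (L + r)}"

definition Uset :: "real \<Rightarrow> real \<Rightarrow> (real^('n::{finite,linorder}) \<Rightarrow> real) \<Rightarrow> real \<Rightarrow> int \<Rightarrow> (real^('n::{finite,linorder})) set" where
  "Uset \<gamma> L \<Phi> \<theta> j = {x \<in> Omega_r \<gamma> L 0.
      (2 * of_int j - 1) * L < \<theta> + \<Phi> (Gam \<gamma> x) \<and> \<theta> + \<Phi> (Gam \<gamma> x) < (2 * of_int j + 1) * L}"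

definition Smap :: "real \<Rightarrow> (real^('n::{finite,linorder}) \<Rightarrow> real) \<Rightarrow> real^('n::{finite,linorder}) \<Rightarrow> real^('n::{finite,linorder})" where
  "Smap \<gamma> \<Phi> u = (\<chi> i. if pos i + 1 < CARD('n) then u $ crd (pos i + 1) / \<gamma>
      else \<gamma> ^ (CARD('n) - 1) * \<Phi> (Gam \<gamma> u))"

definition Tj :: "real \<Rightarrow> real \<Rightarrow> (real^('n::{finite,linorder}) \<Rightarrow> real) \<Rightarrow> real \<Rightarrow> int \<Rightarrow> real^('n::{finite,linorder}) \<Rightarrow> real^('n::{finite,linorder})" where
  "Tj \<gamma> L \<Phi> \<theta> j u = Smap \<gamma> \<Phi> u +
      (\<chi> i. if pos i + 1 = CARD('n) then \<gamma> ^ (CARD('n) - 1) * (\<theta> - 2 * of_int j * L) else 0)"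

text \<open>phi_theta: Phi + theta reduced modulo 2L into [-L,L) (boundary convention
  only affects a null set).\<close>
definition phi_red :: "real \<Rightarrow> (real^'n \<Rightarrow> real) \<Rightarrow> real \<Rightarrow> real^'n \<Rightarrow> real" where
  "phi_red L \<Phi> \<theta> x = \<Phi> x + \<theta> - 2 * L * of_int \<lfloor>(\<Phi> x + \<theta> + L) / (2 * L)\<rfloor>"

definition Ttheta :: "real \<Rightarrow> real \<Rightarrow> (real^('n::{finite,linorder}) \<Rightarrow> real) \<Rightarrow> real \<Rightarrow> real^('n::{finite,linorder}) \<Rightarrow> real^('n::{finite,linorder})" where
  "Ttheta \<gamma> L \<Phi> \<theta> u = (\<chi> i. if pos i + 1 < CARD('n) then u $ crd (pos i + 1) / \<gamma>
      else \<gamma> ^ (CARD('n) - 1) * phi_red L \<Phi> \<theta> (Gam \<gamma> u))"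

definition Vset :: "real \<Rightarrow> real \<Rightarrow> (real^('n::{finite,linorder}) \<Rightarrow> real) \<Rightarrow> real \<Rightarrow> real \<Rightarrow> int \<Rightarrow> (real^('n::{finite,linorder})) set" where
  "Vset \<gamma> L \<Phi> \<theta> \<epsilon>m j = nbhd \<epsilon>m (Uset \<gamma> L \<Phi> \<theta> j)"

definition Jset :: "real \<Rightarrow> real \<Rightarrow> (real^('n::{finite,linorder}) \<Rightarrow> real) \<Rightarrow> real \<Rightarrow> int set" where
  "Jset \<gamma> L \<Phi> \<theta> = {j. Uset \<gamma> L \<Phi> \<theta> j \<noteq> {}}"

definition Gx :: "real \<Rightarrow> real \<Rightarrow> (real^('n::{finite,linorder}) \<Rightarrow> real) \<Rightarrow> real \<Rightarrow> real \<Rightarrow> real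
    \<Rightarrow> real^('n::{finite,linorder}) \<Rightarrow> real \<Rightarrow> real \<Rightarrow> real" where
  "Gx \<gamma> L \<Phi> \<theta> \<sigma> \<epsilon>m x \<epsilon> \<delta> =
     (\<Sum>j\<in>Jset \<gamma> L \<Phi> \<theta>.
        measure lebesgue ({v \<in> Vset \<gamma> L \<Phi> \<theta> \<epsilon>m j.
             Tj \<gamma> L \<Phi> \<theta> j v \<in> nbhd \<epsilon> (frontier (Tj \<gamma> L \<Phi> \<theta> j ` Uset \<gamma> L \<Phi> \<theta> j))}
           \<inter> ball x ((1 - \<sigma> powr (-1/2)) * \<delta>))
        / measure lebesgue (ball x ((1 - \<sigma> powr (-1/2)) * \<delta>)))"

definition Gsup :: "real \<Rightarrow> real \<Rightarrow> (real^('n::{finite,linorder}) \<Rightarrow> real) \<Rightarrow> real \<Rightarrow> real \<Rightarrow> real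
    \<Rightarrow> real \<Rightarrow> real \<Rightarrow> ereal" where
  "Gsup \<gamma> L \<Phi> \<theta> \<sigma> \<epsilon>m \<epsilon> \<delta> = (SUP x. ereal (Gx \<gamma> L \<Phi> \<theta> \<sigma> \<epsilon>m x \<epsilon> \<delta>))"

definition eta :: "real \<Rightarrow> real \<Rightarrow> (real^('n::{finite,linorder}) \<Rightarrow> real) \<Rightarrow> real \<Rightarrow> real \<Rightarrow> real
    \<Rightarrow> real \<Rightarrow> ereal" where
  "eta \<gamma> L \<Phi> \<theta> \<sigma> \<epsilon>m \<delta> = ereal (\<sigma> powr (-1/2))
     + 2 * (SUP \<epsilon>\<in>{0<..\<delta>}. Gsup \<gamma> L \<Phi> \<theta> \<sigma> \<epsilon>m \<epsilon> \<delta> / ereal \<epsilon>) * ereal \<delta>"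

end

theory Submission
  imports Defs
begin

text \<open>
  The last coordinate of S is the only nonlinear one, so the mean value theorem for the scalar
  function \<Phi>0 at a single intermediate point shows that S expands distances by sqrt \<sigma> on the whole
  box.  Injectivity, contraction and smoothness of the inverse branches follow.  The Jacobian
  determinant of S is Lipschitz and has no zero on a compact box, which bounds the distortion of its
  reciprocal.

  For (PE5), a point counted by the branch j lies within \<epsilon> / sqrt \<sigma> of a face of \<Omega>, or its image
  lies within \<epsilon> of a discontinuity level; it can be counted by two branches only in the latter case,
  and never by three.  A small ball meets one face of each of the k opposite pairs and one level, so
  the sum in G is at most k + 2 volumes of sets all of whose slices in some coordinate direction have
  length at most 2 \<epsilon> / sqrt \<sigma>.  Each is bounded by Fubini via the (k-1)-dimensional shadow of the
  ball, and the total is exactly the expression in eta0 at (\<sigma>, k + 2).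
\<close>

section \<open>Expanding maps\<close>

definition expanding_on :: "real \<Rightarrow> 'a::metric_space set \<Rightarrow> ('a \<Rightarrow> 'b::metric_space) \<Rightarrow> bool" where
  "expanding_on c S f \<longleftrightarrow> (\<forall>x\<in>S. \<forall>y\<in>S. c * dist x y \<le> dist (f x) (f y))"

lemma expanding_onI:
  "(\<And>x y. x \<in> S \<Longrightarrow> y \<in> S \<Longrightarrow> c * dist x y \<le> dist (f x) (f y)) \<Longrightarrow> expanding_on c S f"
  by (simp add: expanding_on_def)

lemma expanding_onD:
  "expanding_on c S f \<Longrightarrow> x \<in> S \<Longrightarrow> y \<in> S \<Longrightarrow> c * dist x y \<le> dist (f x) (f y)"
  by (simp add: expanding_on_def)

lemma expanding_on_subset: "expanding_on c S f \<Longrightarrow> T \<subseteq> S \<Longrightarrow> expanding_on c T f"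
  by (auto simp: expanding_on_def)

lemma expanding_on_imp_inj_on:
  assumes "expanding_on c S f" "c > 0" shows "inj_on f S"
proof (rule inj_onI)
  fix x y assume "x \<in> S" "y \<in> S" "f x = f y"
  then have "c * dist x y \<le> 0" using expanding_onD[OF assms(1), of x y] by simp
  then show "x = y" using assms(2) by (simp add: mult_le_0_iff)
qed

lemma lipschitz_on_inv_into_expanding:
  assumes "expanding_on c S f" "c > 0" shows "(1 / c)-lipschitz_on (f ` S) (inv_into S f)"
proof (rule lipschitz_onI)
  fix x y assume xy: "x \<in> f ` S" "y \<in> f ` S"
  then show "dist (inv_into S f x) (inv_into S f y) \<le> 1 / c * dist x y"
    using expanding_onD[OF assms(1) inv_into_into[OF xy(1)] inv_into_into[OF xy(2)]] assms(2)
    by (simp add: f_inv_into_f pos_le_divide_eq mult.commute)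
qed (use assms(2) in simp)

lemma open_image_expanding:
  fixes f :: "'a::euclidean_space \<Rightarrow> 'a"
  assumes "expanding_on c S f" "c > 0" "continuous_on S f" "open S"
  shows "open (f ` S)"
  using assms by (intro invariance_of_domain expanding_on_imp_inj_on)

lemma ball_subset_image_expanding:
  fixes f :: "'a::euclidean_space \<Rightarrow> 'a"
  assumes f: "expanding_on c (cball x r) f" "continuous_on (cball x r) f" and "c > 0" "r > 0"
  shows "ball (f x) (c * r) \<subseteq> f ` ball x r"
proof (rule ball_subset_open_map_image)
  show "continuous_on (closure (ball x r)) f" using assms by simp
  have "open (f ` ball x r)"
    using assms by (intro open_image_expanding[of c] expanding_on_subset[OF f(1)]
      continuous_on_subset[OF f(2)]) auto
  then show "open (f ` interior (ball x r))" by (simp add: interior_open)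
  show "c * r \<le> norm (f z - f x)" if "z \<in> frontier (ball x r)" for z
    using that expanding_onD[OF f(1), of x z] \<open>r > 0\<close> by (simp add: dist_norm norm_minus_commute)
qed (use assms in auto)

lemma negligible_expanding_image_imp:
  fixes f :: "'a::euclidean_space \<Rightarrow> 'b::euclidean_space"
  assumes "DIM('b) \<le> DIM('a)" and f: "expanding_on c S f" "c > 0" and "negligible (f ` S)"
  shows "negligible S"
proof -
  have "\<exists>W B. open W \<and> x \<in> W \<and>
      (\<forall>y\<in>f ` S \<inter> W. norm (inv_into S f y - inv_into S f x) \<le> B * norm (y - x))"
    if "x \<in> f ` S" for x
    using that lipschitz_on_normD[OF lipschitz_on_inv_into_expanding[OF f]]
    by (intro exI[of _ UNIV] exI[of _ "1 / c"]) auto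
  then have "negligible (inv_into S f ` f ` S)"
    by (rule negligible_locally_Lipschitz_image[OF assms(1) \<open>negligible (f ` S)\<close>])
  then show ?thesis by (simp add: expanding_on_imp_inj_on[OF f])
qed

lemma frontier_injective_image_subset:
  fixes f :: "'a::euclidean_space \<Rightarrow> 'a"
  assumes "open S" "bounded S" and f: "continuous_on (closure S) f" "inj_on f S"
  shows "frontier (f ` S) \<subseteq> f ` frontier S"
proof -
  have "open (f ` S)"
    by (rule invariance_of_domain[OF continuous_on_subset[OF f(1) closure_subset] \<open>open S\<close> f(2)])
  moreover have "closure (f ` S) \<subseteq> f ` closure S"
  proof (rule closure_minimal[OF image_mono[OF closure_subset]])
    have "compact (f ` closure S)"
      using f(1) \<open>bounded S\<close> by (intro compact_continuous_image) (simp_all add: compact_closure)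
    then show "closed (f ` closure S)" by (rule compact_imp_closed)
  qed
  ultimately show ?thesis using \<open>open S\<close> by (auto simp: frontier_def interior_open)
qed

lemma has_derivative_difference_quotient:
  fixes f :: "'a::real_normed_vector \<Rightarrow> 'b::real_normed_vector"
  assumes f: "(f has_derivative f') (at x)"
  shows "((\<lambda>t. (f (x + t *\<^sub>R h) - f x) /\<^sub>R t) \<longlongrightarrow> f' h) (at 0)"
proof -
  define p where "p t = x + t *\<^sub>R h" for t :: real
  have p: "p 0 = x" "(p has_derivative (\<lambda>t. t *\<^sub>R h)) (at 0)"
    unfolding p_def by (auto intro!: derivative_eq_intros)
  have "((\<lambda>t. f (p t)) has_derivative (\<lambda>t. f' (t *\<^sub>R h))) (at 0)"
    by (rule has_derivative_compose[OF p(2)]) (simp add: p(1) f)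
  moreover have "f' (t *\<^sub>R h) = t *\<^sub>R f' h" for t
    using linear_cmul[OF has_derivative_linear[OF f]] .
  ultimately have "((\<lambda>t. norm (f (p t) - f x - t *\<^sub>R f' h) / \<bar>t\<bar>) \<longlongrightarrow> 0) (at 0)"
    by (simp add: has_derivative_iff_norm p(1))
  moreover have "\<forall>\<^sub>F t in at 0. norm (f (p t) - f x - t *\<^sub>R f' h) / \<bar>t\<bar>
      = norm ((f (p t) - f x) /\<^sub>R t - f' h)"
    using eventually_neq_at_within[of 0 0 UNIV]
  proof eventually_elim
    case (elim t)
    then have remainder: "f (p t) - f x - t *\<^sub>R f' h = t *\<^sub>R ((f (p t) - f x) /\<^sub>R t - f' h)"
      by (simp add: scaleR_diff_right)
    show "norm (f (p t) - f x - t *\<^sub>R f' h) / \<bar>t\<bar> = norm ((f (p t) - f x) /\<^sub>R t - f' h)"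
      unfolding remainder norm_scaleR using elim by simp
  qed
  ultimately have "((\<lambda>t. norm ((f (p t) - f x) /\<^sub>R t - f' h)) \<longlongrightarrow> 0) (at 0)"
    by (rule Lim_transform_eventually)
  then show ?thesis
    unfolding p_def by (rule LIM_zero_cancel[OF tendsto_norm_zero_cancel])
qed

lemma has_derivative_expanding_ge:
  fixes f :: "'a::real_normed_vector \<Rightarrow> 'b::real_normed_vector"
  assumes f: "(f has_derivative f') (at x)" and S: "expanding_on c S f" "open S" "x \<in> S"
  shows "c * norm h \<le> norm (f' h)"
proof (rule tendsto_lowerbound)
  show "((\<lambda>t. norm ((f (x + t *\<^sub>R h) - f x) /\<^sub>R t)) \<longlongrightarrow> norm (f' h)) (at 0)"
    by (rule tendsto_norm[OF has_derivative_difference_quotient[OF f]])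
  have "((\<lambda>t. x + t *\<^sub>R h) \<longlongrightarrow> x + 0 *\<^sub>R h) (at 0)" by (intro tendsto_intros)
  then have "((\<lambda>t. x + t *\<^sub>R h) \<longlongrightarrow> x) (at 0)" by simp
  from topological_tendstoD[OF this S(2,3)] eventually_neq_at_within[of 0 0 UNIV]
  show "\<forall>\<^sub>F t in at 0. c * norm h \<le> norm ((f (x + t *\<^sub>R h) - f x) /\<^sub>R t)"
  proof eventually_elim
    case (elim t)
    then have "c * (\<bar>t\<bar> * norm h) \<le> norm (f (x + t *\<^sub>R h) - f x)"
      using expanding_onD[OF S(1,3), of "x + t *\<^sub>R h"] by (simp add: dist_norm norm_minus_commute)
    then show ?case
      using elim(2) by (simp add: pos_le_divide_eq mult_ac flip: divide_inverse_commute)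
  qed
qed simp

section \<open>C2 maps and their inverses\<close>

interpretation blinfun_compose: bounded_bilinear "(o\<^sub>L)"
  by (rule bounded_bilinear_blinfun_compose)

lemma blinfun_compose_assoc: "(a o\<^sub>L b) o\<^sub>L c = a o\<^sub>L (b o\<^sub>L c)"
  by (rule blinfun_eqI) simp

definition blinfun_sandwich ::
    "('c::real_normed_vector \<Rightarrow>\<^sub>L 'd::real_normed_vector) \<Rightarrow>
      ('a::real_normed_vector \<Rightarrow>\<^sub>L 'b::real_normed_vector) \<Rightarrow> ('b \<Rightarrow>\<^sub>L 'c) \<Rightarrow>\<^sub>L ('a \<Rightarrow>\<^sub>L 'd)" where
  "blinfun_sandwich A B = blinfun_compose.prod_right A o\<^sub>L blinfun_compose.prod_left B"

lemma blinfun_apply_sandwich [simp]: "blinfun_sandwich A B X = A o\<^sub>L X o\<^sub>L B"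
  by (simp add: blinfun_sandwich_def blinfun_compose_assoc)

lemma continuous_on_blinfun_sandwich:
  "continuous_on S a \<Longrightarrow> continuous_on S b \<Longrightarrow> continuous_on S (\<lambda>x. blinfun_sandwich (a x) (b x))"
  unfolding blinfun_sandwich_def
  by (intro continuous_intros
      bounded_linear.continuous_on[OF blinfun_compose.bounded_linear_prod_left]
      bounded_linear.continuous_on[OF blinfun_compose.bounded_linear_prod_right])

lemma has_derivative_bilinear_vanishing:
  assumes B: "bounded_bilinear B"
    and f: "isCont f x" and g: "(g has_derivative g') (at x)" and g0: "g x = 0"
  shows "((\<lambda>y. B (f y) (g y)) has_derivative (\<lambda>h. B (f x) (g' h))) (at x)"
proof -
  interpret B: bounded_bilinear B by (rule B)
  obtain K where K: "K > 0" "\<And>a b. norm (B a b) \<le> norm a * norm b * K"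
    using B.pos_bounded by blast
  have g': "bounded_linear g'" using g by (rule has_derivative_bounded_linear)
  then obtain M where M: "\<And>h. norm (g' h) \<le> norm h * M" using bounded_linear.bounded by blast
  define r where "r y = norm (g y - g' (y - x)) / norm (y - x)" for y
  have r: "(r \<longlongrightarrow> 0) (at x)" using g by (simp add: has_derivative_iff_norm r_def[abs_def] g0)
  show ?thesis
    unfolding has_derivative_iff_norm
  proof
    show "bounded_linear (\<lambda>h. B (f x) (g' h))"
      by (rule bounded_linear_compose[OF B.bounded_linear_right g'])
    have "norm (B (f y) (g y) - B (f x) (g x) - B (f x) (g' (y - x))) / norm (y - x)
        \<le> norm (f y) * r y * K + norm (f y - f x) * M * K" (is "?q y \<le> ?b y") if "y \<noteq> x" for y
    proof -
      have "B (f y) (g y) - B (f x) (g x) - B (f x) (g' (y - x))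
          = B (f y) (g y - g' (y - x)) + B (f y - f x) (g' (y - x))"
        by (simp add: g0 B.zero_right B.diff_left B.diff_right)
      also have "norm \<dots> \<le> norm (f y) * norm (g y - g' (y - x)) * K
          + norm (f y - f x) * (norm (y - x) * M) * K"
        using K M by (intro norm_triangle_le add_mono order_trans[OF K(2)] mult_right_mono
          mult_left_mono) auto
      also have "\<dots> = ?b y * norm (y - x)" using that by (simp add: r_def field_simps)
      finally show ?thesis using that by (simp add: pos_divide_le_eq)
    qed
    then have "\<forall>\<^sub>F y in at x. norm (?q y) \<le> ?b y" by (simp add: eventually_at_filter)
    moreover have "((\<lambda>y. ?b y) \<longlongrightarrow> norm (f x) * 0 * K + norm (f x - f x) * M * K) (at x)"
      using f r unfolding isCont_def by (intro tendsto_intros)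
    then have "((\<lambda>y. ?b y) \<longlongrightarrow> 0) (at x)" by simp
    ultimately show "((\<lambda>y. ?q y) \<longlongrightarrow> 0) (at x)" by (rule Lim_null_comparison)
  qed
qed

lemma blinfun_inverse_eq_minus:
  assumes "N' o\<^sub>L M' = id_blinfun" "M o\<^sub>L N = id_blinfun"
  shows "N' = N - (N' o\<^sub>L ((M' - M) o\<^sub>L N))"
proof -
  have "N' o\<^sub>L (M' o\<^sub>L N) = N" "N' o\<^sub>L (M o\<^sub>L N) = N'"
    using assms
    by (simp_all flip: blinfun_compose_assoc) (simp_all add: blinfun_eqI blinfun_compose_assoc)
  then show ?thesis by (simp add: blinfun_compose.diff_left blinfun_compose.diff_right)
qed

lemma has_derivative_blinfun_inverse:
  fixes M :: "'a::real_normed_vector \<Rightarrow> 'b::real_normed_vector \<Rightarrow>\<^sub>L 'c::real_normed_vector"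
  assumes S: "open S" "z \<in> S"
    and NM: "\<And>y. y \<in> S \<Longrightarrow> N y o\<^sub>L M y = id_blinfun" and MN: "\<And>y. y \<in> S \<Longrightarrow> M y o\<^sub>L N y = id_blinfun"
    and bound: "\<And>y. y \<in> S \<Longrightarrow> norm (N y) \<le> b"
    and M: "(M has_derivative M') (at z)"
  shows "(N has_derivative (\<lambda>h. - (N z o\<^sub>L M' h o\<^sub>L N z))) (at z)"
proof -
  define E where "E y = (M y - M z) o\<^sub>L N z" for y
  have resolvent: "N y = N z - (N y o\<^sub>L E y)" if "y \<in> S" for y
    unfolding E_def by (rule blinfun_inverse_eq_minus[OF NM[OF that] MN[OF S(2)]])
  have E: "E z = 0" "(E has_derivative (\<lambda>h. M' h o\<^sub>L N z)) (at z)"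
    unfolding E_def
    using bounded_linear.has_derivative[OF blinfun_compose.bounded_linear_left
        has_derivative_diff[OF M has_derivative_const]] by simp_all
  have "((\<lambda>y. N y - N z) \<longlongrightarrow> 0) (at z)"
  proof (rule Lim_null_comparison)
    show "\<forall>\<^sub>F y in at z. norm (N y - N z) \<le> b * norm (E y)"
      using eventually_at_in_open'[OF S]
    proof eventually_elim
      case (elim y)
      have "norm (N y - N z) = norm (N y o\<^sub>L E y)" by (subst resolvent[OF elim]) simp
      also have "\<dots> \<le> b * norm (E y)"
        using bound[OF elim] by (intro order_trans[OF norm_blinfun_compose] mult_right_mono) auto
      finally show ?case .
    qed
    have "(E \<longlongrightarrow> 0) (at z)"
      using has_derivative_continuous[OF E(2)] E(1) by (simp add: continuous_at)
    then show "((\<lambda>y. b * norm (E y)) \<longlongrightarrow> 0) (at z)"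
      by (intro tendsto_mult_right_zero tendsto_norm_zero)
  qed
  then have "isCont N z" unfolding isCont_def by (rule LIM_zero_cancel)
  then have "((\<lambda>y. N z - (N y o\<^sub>L E y)) has_derivative (\<lambda>h. 0 - (N z o\<^sub>L (M' h o\<^sub>L N z)))) (at z)"
    by (intro has_derivative_diff has_derivative_const
        has_derivative_bilinear_vanishing[OF bounded_bilinear_blinfun_compose _ E(2,1)])
  then have "((\<lambda>y. N z - (N y o\<^sub>L E y)) has_derivative (\<lambda>h. - (N z o\<^sub>L M' h o\<^sub>L N z))) (at z)"
    by (simp add: blinfun_compose_assoc)
  then show ?thesis
    by (rule has_derivative_transform_within_open[OF _ S]) (simp flip: resolvent)
qed

lemma C2_onI:
  assumes "\<And>x. x \<in> S \<Longrightarrow> (f has_derivative blinfun_apply (f' x)) (at x)"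
    "\<And>x. x \<in> S \<Longrightarrow> (f' has_derivative blinfun_apply (f'' x)) (at x)" "continuous_on S f''"
  shows "C2_on S f"
  using assms unfolding C2_on_def by blast

lemma C2_on_subset: "C2_on S f \<Longrightarrow> T \<subseteq> S \<Longrightarrow> C2_on T f"
  unfolding C2_on_def by (elim exE conjE, intro exI conjI) (auto intro: continuous_on_subset)

lemma C2_on_imp_differentiable: "C2_on S f \<Longrightarrow> x \<in> S \<Longrightarrow> f differentiable (at x)"
  unfolding C2_on_def differentiable_def by blast

lemma C2_on_imp_continuous_on: "C2_on S f \<Longrightarrow> continuous_on S f"
  by (meson C2_on_imp_differentiable continuous_at_imp_continuous_on
      differentiable_imp_continuous_within)

lemma C2_on_const: "C2_on S (\<lambda>x. c)"
  by (rule C2_onI[where f' = "\<lambda>x. 0" and f'' = "\<lambda>x. 0"]) (auto simp: zero_blinfun.rep_eq)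

lemma C2_on_bounded_linear: "bounded_linear A \<Longrightarrow> C2_on S A"
  by (rule C2_onI[where f' = "\<lambda>x. Blinfun A" and f'' = "\<lambda>x. 0"])
     (auto simp: bounded_linear_Blinfun_apply zero_blinfun.rep_eq bounded_linear_imp_has_derivative)

lemma C2_on_add:
  assumes "C2_on S f" "C2_on S g" shows "C2_on S (\<lambda>x. f x + g x)"
proof -
  obtain f' f'' where f: "\<And>x. x \<in> S \<Longrightarrow> (f has_derivative blinfun_apply (f' x)) (at x)"
    "\<And>x. x \<in> S \<Longrightarrow> (f' has_derivative blinfun_apply (f'' x)) (at x)" "continuous_on S f''"
    using assms(1) unfolding C2_on_def by metis
  obtain g' g'' where g: "\<And>x. x \<in> S \<Longrightarrow> (g has_derivative blinfun_apply (g' x)) (at x)"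
    "\<And>x. x \<in> S \<Longrightarrow> (g' has_derivative blinfun_apply (g'' x)) (at x)" "continuous_on S g''"
    using assms(2) unfolding C2_on_def by metis
  show ?thesis
    by (rule C2_onI[where f' = "\<lambda>x. f' x + g' x" and f'' = "\<lambda>x. f'' x + g'' x"])
       (auto simp: plus_blinfun.rep_eq intro!: has_derivative_add f g continuous_intros)
qed

lemma C2_on_compose_bounded_linear:
  assumes f: "C2_on S f" and A: "bounded_linear A" and G: "bounded_linear G" and GT: "G ` T \<subseteq> S"
  shows "C2_on T (\<lambda>x. A (f (G x)))"
proof -
  obtain f' f'' where f': "\<And>x. x \<in> S \<Longrightarrow> (f has_derivative blinfun_apply (f' x)) (at x)"
    and f'': "\<And>x. x \<in> S \<Longrightarrow> (f' has_derivative blinfun_apply (f'' x)) (at x)"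
    and cont_f'': "continuous_on S f''"
    using f unfolding C2_on_def by metis
  obtain bA bG where blinfuns: "A = blinfun_apply bA" "G = blinfun_apply bG"
    using A G by (metis bounded_linear_Blinfun_apply)
  note G' = bounded_linear_imp_has_derivative[OF G]
  let ?Q = "blinfun_sandwich bA bG"
  show ?thesis
  proof (rule C2_onI[where f' = "\<lambda>x. ?Q (f' (G x))" and f'' = "\<lambda>x. ?Q o\<^sub>L f'' (G x) o\<^sub>L bG"])
    fix x assume "x \<in> T"
    then have x: "G x \<in> S" using GT by blast
    show "((\<lambda>x. A (f (G x))) has_derivative ?Q (f' (G x))) (at x)"
      using bounded_linear.has_derivative[OF A has_derivative_compose[OF G' f'[OF x]]]
      by (simp add: blinfuns blinfun_compose.rep_eq o_def)
    show "((\<lambda>x. ?Q (f' (G x))) has_derivative ?Q o\<^sub>L f'' (G x) o\<^sub>L bG) (at x)"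
      using bounded_linear.has_derivative[OF blinfun.bounded_linear_right
        has_derivative_compose[OF G' f''[OF x]], of ?Q]
      by (simp add: blinfuns(2) blinfun_compose.rep_eq o_def)
  qed (intro continuous_intros continuous_on_compose2[OF cont_f'' linear_continuous_on[OF G] GT])
qed

lemma expanding_on_derivative_invertible:
  fixes f' :: "'a::euclidean_space \<Rightarrow>\<^sub>L 'a"
  assumes f: "(f has_derivative blinfun_apply f') (at x)"
    and S: "expanding_on c S f" "c > 0" "open S" "x \<in> S"
  obtains n where "n o\<^sub>L f' = id_blinfun" "f' o\<^sub>L n = id_blinfun" "norm n \<le> 1 / c"
proof -
  note lin = has_derivative_linear[OF f]
  note lower_bound = has_derivative_expanding_ge[OF f S(1,3,4)]
  have "inj (blinfun_apply f')"
    unfolding linear_injective_0[OF lin]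
    using lower_bound S(2) by (metis mult_pos_pos norm_zero not_less zero_less_norm_iff)
  then obtain n where n: "linear n" "\<And>h. n (f' h) = h" "\<And>h. f' (n h) = h"
    using linear_injective_isomorphism[OF lin] by blast
  then have apply_n: "blinfun_apply (Blinfun n) = n"
    by (simp add: bounded_linear_Blinfun_apply linear_conv_bounded_linear)
  have "norm (n h) \<le> 1 / c * norm h" for h
    using lower_bound[of "n h"] n(3)[of h] S(2) by (simp add: field_simps)
  then show ?thesis
    using S(2) by (intro that[of "Blinfun n"] norm_blinfun_bound blinfun_eqI) (auto simp: apply_n n)
qed

lemma has_derivative_inv_into_expanding:
  fixes f :: "'a::euclidean_space \<Rightarrow> 'a"
  assumes S: "expanding_on c S f" "c > 0" "open S" "continuous_on S f"
    and x: "x \<in> S" and f': "(f has_derivative blinfun_apply f') (at x)"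
    and n: "n o\<^sub>L f' = id_blinfun"
  shows "(inv_into S f has_derivative blinfun_apply n) (at (f x))"
proof (rule has_derivative_inverse_basic)
  have open_image: "open (f ` S)" by (rule open_image_expanding[OF S(1,2,4,3)])
  show "open (f ` S)" "f x \<in> f ` S" by (simp_all add: open_image x)
  show "f (inv_into S f y) = y" if "y \<in> f ` S" for y using that by (rule f_inv_into_f)
  show "(f has_derivative blinfun_apply f') (at (inv_into S f (f x)))"
    using f' x expanding_on_imp_inj_on[OF S(1,2)] by simp
  show "bounded_linear (blinfun_apply n)" by (rule blinfun.bounded_linear_right)
  have "blinfun_apply (n o\<^sub>L f') h = h" for h unfolding n by simp
  then show "blinfun_apply n \<circ> blinfun_apply f' = id" by (auto simp: fun_eq_iff)
  have "continuous_on (f ` S) (inv_into S f)"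
    by (rule lipschitz_on_continuous_on[OF lipschitz_on_inv_into_expanding[OF S(1,2)]])
  then show "continuous (at (f x)) (inv_into S f)"
    using open_image x by (simp add: continuous_on_eq_continuous_at)
qed

lemma C2_on_inv_into_expanding:
  fixes f :: "'a::euclidean_space \<Rightarrow> 'a"
  assumes f: "C2_on S f" and S: "expanding_on c S f" "c > 0" "open S"
  shows "C2_on (f ` S) (inv_into S f)"
proof -
  obtain f' f'' where f': "\<And>x. x \<in> S \<Longrightarrow> (f has_derivative blinfun_apply (f' x)) (at x)"
    and f'': "\<And>x. x \<in> S \<Longrightarrow> (f' has_derivative blinfun_apply (f'' x)) (at x)"
    and cont_f'': "continuous_on S f''"
    using f unfolding C2_on_def by metis
  note cont = C2_on_imp_continuous_on[OF f]
  have open_image: "open (f ` S)" by (rule open_image_expanding[OF S(1,2) cont S(3)])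
  let ?g = "inv_into S f"
  have g: "?g y \<in> S" "f (?g y) = y" if "y \<in> f ` S" for y
    using that by (auto simp: inv_into_into f_inv_into_f)
  have "\<forall>x\<in>S. \<exists>n. n o\<^sub>L f' x = id_blinfun \<and> f' x o\<^sub>L n = id_blinfun \<and> norm n \<le> 1 / c"
    using expanding_on_derivative_invertible[OF f' S] by metis
  then obtain n where n: "n x o\<^sub>L f' x = id_blinfun" "f' x o\<^sub>L n x = id_blinfun"
      "norm (n x) \<le> 1 / c" if "x \<in> S" for x
    by metis
  define N where "N y = n (?g y)" for y
  have N: "(?g has_derivative blinfun_apply (N y)) (at y)" if "y \<in> f ` S" for y
    using has_derivative_inv_into_expanding[OF S cont g(1)[OF that] f'[OF g(1)[OF that]]
      n(1)[OF g(1)[OF that]]]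
    by (simp add: N_def g(2)[OF that])
  have N': "(N has_derivative - (blinfun_sandwich (N y) (N y) o\<^sub>L (f'' (?g y) o\<^sub>L N y))) (at y)"
    if y: "y \<in> f ` S" for y
  proof -
    have "(N has_derivative (\<lambda>h. - (N y o\<^sub>L f'' (?g y) (N y h) o\<^sub>L N y))) (at y)"
      using n g has_derivative_compose[OF N[OF y] f''[OF g(1)[OF y]]]
      by (intro has_derivative_blinfun_inverse[OF open_image y, of N "\<lambda>y. f' (?g y)" "1 / c"])
          (auto simp: N_def)
    then show ?thesis
      by (rule has_derivative_eq_rhs) (simp add: fun_eq_iff uminus_blinfun.rep_eq)
  qed
  show ?thesis
  proof (rule C2_onI[OF N N'])
    have cont_N: "continuous_on (f ` S) N" and cont_g: "continuous_on (f ` S) ?g"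
      using N N' by (meson continuous_at_imp_continuous_on has_derivative_continuous)+
    show "continuous_on (f ` S) (\<lambda>y. - (blinfun_sandwich (N y) (N y) o\<^sub>L (f'' (?g y) o\<^sub>L N y)))"
      by (intro continuous_intros continuous_on_blinfun_sandwich cont_N
          continuous_on_compose2[OF cont_f'' cont_g]) (use g in auto)
  qed
qed

theorem C2_diffeo_on_expanding:
  fixes f :: "'a::euclidean_space \<Rightarrow> 'a"
  assumes f: "C2_on S f" and S: "expanding_on c S f" "c > 0" "open S"
  shows "C2_diffeo_on S f"
  unfolding C2_diffeo_on_def
  using f S C2_on_inv_into_expanding[OF f S] expanding_on_imp_inj_on[OF S(1,2)]
    open_image_expanding[OF S(1,2) C2_on_imp_continuous_on[OF f] S(3)]
  by blast

section \<open>Distortion of the Jacobian determinant\<close>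

lemma lipschitz_on_mult_compact:
  fixes f g :: "'a::metric_space \<Rightarrow> real"
  assumes "compact C" and f: "F-lipschitz_on C f" and g: "G-lipschitz_on C g"
  shows "\<exists>L. L-lipschitz_on C (\<lambda>x. f x * g x)"
proof -
  have bounded: "\<exists>B\<ge>0. \<forall>x\<in>C. \<bar>h x\<bar> \<le> B" if "H-lipschitz_on C h" for h :: "'a \<Rightarrow> real" and H
    using compact_imp_bounded[OF compact_continuous_image[OF lipschitz_on_continuous_on[OF that]
      \<open>compact C\<close>]]
    unfolding bounded_pos by (auto intro: less_imp_le)
  obtain A B where A: "A \<ge> 0" "\<And>x. x \<in> C \<Longrightarrow> \<bar>f x\<bar> \<le> A" and B: "B \<ge> 0" "\<And>x. x \<in> C \<Longrightarrow> \<bar>g x\<bar> \<le> B"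
    using bounded[OF f] bounded[OF g] by blast
  have "(A * G + F * B)-lipschitz_on C (\<lambda>x. f x * g x)"
  proof (rule lipschitz_onI)
    fix x y assume xy: "x \<in> C" "y \<in> C"
    have "f x * g x - f y * g y = f x * (g x - g y) + (f x - f y) * g y"
      by (simp add: algebra_simps)
    then have "dist (f x * g x) (f y * g y) \<le> \<bar>f x\<bar> * dist (g x) (g y) + dist (f x) (f y) * \<bar>g y\<bar>"
      unfolding dist_real_def by (metis abs_mult abs_triangle_ineq)
    also have "\<dots> \<le> A * (G * dist x y) + F * dist x y * B"
      using A B xy lipschitz_onD[OF f xy] lipschitz_onD[OF g xy] lipschitz_on_nonneg[OF f]
      by (intro add_mono mult_mono) auto
    finally show "dist (f x * g x) (f y * g y) \<le> (A * G + F * B) * dist x y"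
      by (simp add: algebra_simps)
  qed (use A B lipschitz_on_nonneg[OF f] lipschitz_on_nonneg[OF g] in simp)
  then show ?thesis ..
qed

lemma lipschitz_on_prod_compact:
  fixes f :: "'i \<Rightarrow> 'a::metric_space \<Rightarrow> real"
  assumes "compact C" "finite I" "\<And>i. i \<in> I \<Longrightarrow> \<exists>L. L-lipschitz_on C (f i)"
  shows "\<exists>L. L-lipschitz_on C (\<lambda>x. \<Prod>i\<in>I. f i x)"
  using assms(2,3)
proof (induction I rule: finite_induct)
  case (insert i I)
  have "\<exists>F. F-lipschitz_on C (f i)" "\<exists>G. G-lipschitz_on C (\<lambda>x. \<Prod>i\<in>I. f i x)"
    using insert.prems by (simp_all add: insert.IH)
  then show ?case using lipschitz_on_mult_compact[OF assms(1)] insert.hyps by auto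
qed (auto intro: lipschitz_on_constant)

lemma lipschitz_on_sum:
  fixes f :: "'i \<Rightarrow> 'a::metric_space \<Rightarrow> 'b::real_normed_vector"
  assumes "\<And>i. i \<in> I \<Longrightarrow> \<exists>L. L-lipschitz_on C (f i)"
  shows "\<exists>L. L-lipschitz_on C (\<lambda>x. \<Sum>i\<in>I. f i x)"
  using assms
proof (induction I rule: infinite_finite_induct)
  case (insert i I)
  have "\<exists>F. F-lipschitz_on C (f i)" "\<exists>G. G-lipschitz_on C (\<lambda>x. \<Sum>i\<in>I. f i x)"
    using insert.prems by (simp_all add: insert.IH)
  then show ?case using lipschitz_on_add[of _ C "f i"] insert.hyps by auto
qed (auto intro: lipschitz_on_constant)

lemma lipschitz_on_det_compact:
  fixes A :: "'a::metric_space \<Rightarrow> real^'n^'n"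
  assumes "compact C" "\<And>i j. \<exists>L. L-lipschitz_on C (\<lambda>x. A x $ i $ j)"
  shows "\<exists>L. L-lipschitz_on C (\<lambda>x. det (A x))"
  unfolding det_def
proof (rule lipschitz_on_sum)
  fix p :: "'n \<Rightarrow> 'n"
  obtain L where "L-lipschitz_on C (\<lambda>x. \<Prod>i\<in>UNIV. A x $ i $ p i)"
    using lipschitz_on_prod_compact[OF assms(1), of UNIV "\<lambda>i x. A x $ i $ p i"] assms(2) by auto
  from lipschitz_on_cmult_real[OF this]
  show "\<exists>L. L-lipschitz_on C (\<lambda>x. of_int (sign p) * (\<Prod>i\<in>UNIV. A x $ i $ p i))" ..
qed

lemma C1_imp_lipschitz_on_compact_convex:
  fixes f :: "'a::real_normed_vector \<Rightarrow> 'b::real_normed_vector"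
  assumes C: "compact C" "convex C"
    and f': "\<And>x. x \<in> C \<Longrightarrow> (f has_derivative blinfun_apply (f' x)) (at x)"
    and cont: "continuous_on C f'"
  shows "\<exists>L. L-lipschitz_on C f"
proof -
  obtain B where B: "B > 0" "\<And>x. x \<in> C \<Longrightarrow> norm (f' x) \<le> B"
    using compact_imp_bounded[OF compact_continuous_image[OF cont C(1)]] by (auto simp: bounded_pos)
  have "B-lipschitz_on C f"
    by (rule bounded_derivative_imp_lipschitz[OF has_derivative_at_withinI[OF f'] C(2)])
       (use B in \<open>auto simp: less_imp_le simp flip: norm_blinfun.rep_eq\<close>)
  then show ?thesis ..
qed

lemma jac_det_eq: "(f has_derivative f') (at x) \<Longrightarrow> jac_det f x = det (matrix f')"
  using frechet_derivative_at[of f f' x] by (simp add: jac_det_def)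

lemma C2_on_imp_lipschitz_on_jac_det:
  fixes f :: "real^'n \<Rightarrow> real^'n"
  assumes f: "C2_on S f" and C: "compact C" "convex C" "C \<subseteq> S"
  shows "\<exists>L. L-lipschitz_on C (jac_det f)"
proof -
  obtain f' f'' where f': "\<And>x. x \<in> S \<Longrightarrow> (f has_derivative blinfun_apply (f' x)) (at x)"
    and f'': "\<And>x. x \<in> S \<Longrightarrow> (f' has_derivative blinfun_apply (f'' x)) (at x)"
    and cont: "continuous_on S f''"
    using f unfolding C2_on_def by metis
  obtain L where L: "L-lipschitz_on C f'"
    using C1_imp_lipschitz_on_compact_convex[OF C(1,2) f''[OF subsetD[OF C(3)]]
      continuous_on_subset[OF cont C(3)]]
    by blast
  have "\<exists>M. M-lipschitz_on C (\<lambda>x. matrix (blinfun_apply (f' x)) $ i $ j)" for i j :: 'n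
  proof -
    have "bounded_linear (\<lambda>F :: (real^'n) \<Rightarrow>\<^sub>L (real^'n). blinfun_apply F (axis j 1) $ i)"
      by (intro bounded_linear_intros bounded_linear_compose[OF bounded_linear_vec_nth])
    then obtain B where "B-lipschitz_on (f' ` C)
        (\<lambda>F :: (real^'n) \<Rightarrow>\<^sub>L (real^'n). blinfun_apply F (axis j 1) $ i)"
      using bounded_linear.lipschitz_boundE by blast
    from lipschitz_on_compose2[OF L this] show ?thesis by (auto simp: matrix_def)
  qed
  then obtain M where "M-lipschitz_on C (\<lambda>x. det (matrix (blinfun_apply (f' x))))"
    using lipschitz_on_det_compact[OF C(1), of "\<lambda>x. matrix (blinfun_apply (f' x))"] by blast
  then have "M-lipschitz_on C (jac_det f)"
    by (rule lipschitz_on_transform) (use jac_det_eq[OF f'] C(3) in auto)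
  then show ?thesis ..
qed

lemma jac_det_inv_into_expanding:
  fixes f :: "real^'n \<Rightarrow> real^'n"
  assumes S: "expanding_on c S f" "c > 0" "open S" and f: "C2_on S f" and x: "x \<in> S"
  shows "jac_det f x \<noteq> 0" "jac_det (inv_into S f) (f x) = 1 / jac_det f x"
proof -
  obtain f' where f': "(f has_derivative blinfun_apply f') (at x)"
    using f x unfolding C2_on_def by metis
  obtain n where n: "n o\<^sub>L f' = id_blinfun"
    using expanding_on_derivative_invertible[OF f' S x] by metis
  have inv': "(inv_into S f has_derivative blinfun_apply n) (at (f x))"
    by (rule has_derivative_inv_into_expanding[OF S C2_on_imp_continuous_on[OF f] x f' n])
  have "blinfun_apply n \<circ> blinfun_apply f' = id"
    using arg_cong[OF n, of blinfun_apply] by (simp add: blinfun_compose.rep_eq id_def)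
  then have "matrix (blinfun_apply n) ** matrix (blinfun_apply f') = mat 1"
    using matrix_compose[OF has_derivative_linear[OF f'] has_derivative_linear[OF inv']]
    by (simp add: matrix_id_mat_1)
  then have "jac_det (inv_into S f) (f x) * jac_det f x = 1"
    unfolding jac_det_eq[OF f'] jac_det_eq[OF inv'] by (metis det_I det_mul)
  then show "jac_det f x \<noteq> 0" "jac_det (inv_into S f) (f x) = 1 / jac_det f x"
    by (auto simp: eq_divide_eq)
qed

definition bounded_distortion_on :: "real \<Rightarrow> 'a::metric_space set \<Rightarrow> ('a \<Rightarrow> real) \<Rightarrow> bool" where
  "bounded_distortion_on K C g \<longleftrightarrow>
    (\<forall>x\<in>C. \<forall>y\<in>C. \<forall>z\<in>C. \<bar>g x - g y\<bar> \<le> K * \<bar>g z\<bar> * dist x y)"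

lemma bounded_distortion_on_ballD:
  assumes g: "bounded_distortion_on K C g" "K > 0"
    and z: "z \<in> C" and xy: "x \<in> ball z \<epsilon> \<inter> C" "y \<in> ball z \<epsilon> \<inter> C"
  shows "\<bar>g x - g y\<bar> \<le> 2 * K * \<bar>g z\<bar> * \<epsilon>"
proof -
  have "\<bar>g x - g y\<bar> \<le> K * \<bar>g z\<bar> * dist x y"
    using g(1) z xy by (auto simp: bounded_distortion_on_def)
  also have "\<dots> \<le> K * \<bar>g z\<bar> * (2 * \<epsilon>)"
    using g(2) xy dist_triangle3[of x y z] by (intro mult_left_mono) auto
  finally show ?thesis by (simp add: mult_ac)
qed

lemma reciprocal_bounded_distortion_on_compact:
  fixes m :: "'a::metric_space \<Rightarrow> real"
  assumes C: "compact C" and m: "L-lipschitz_on C m" and m0: "\<And>x. x \<in> C \<Longrightarrow> m x \<noteq> 0"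
  shows "\<exists>K>0. bounded_distortion_on K C (\<lambda>x. 1 / m x)"
proof -
  note cont = lipschitz_on_continuous_on[OF m]
  obtain B where B: "B > 0" "\<And>x. x \<in> C \<Longrightarrow> \<bar>m x\<bar> \<le> B"
    using compact_imp_bounded[OF compact_continuous_image[OF cont C]] by (auto simp: bounded_pos)
  have "continuous_on C (\<lambda>x. 1 / m x)" using m0 by (intro continuous_intros cont) simp
  then obtain A where A: "A > 0" "\<And>x. x \<in> C \<Longrightarrow> \<bar>1 / m x\<bar> \<le> A"
    using compact_imp_bounded[OF compact_continuous_image[OF _ C], of "\<lambda>x. 1 / m x"]
    by (auto simp: bounded_pos)
  define K where "K = A * A * (L + 1) * B"
  have L: "L \<ge> 0" by (rule lipschitz_on_nonneg[OF m])
  have "bounded_distortion_on K C (\<lambda>x. 1 / m x)"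
    unfolding bounded_distortion_on_def
  proof (intro ballI)
    fix x y z assume xyz: "x \<in> C" "y \<in> C" "z \<in> C"
    have "1 / m x - 1 / m y = 1 / m x * (1 / m y) * (m y - m x)"
      using m0[OF xyz(1)] m0[OF xyz(2)] by (simp add: field_simps)
    then have "\<bar>1 / m x - 1 / m y\<bar> = \<bar>1 / m x\<bar> * \<bar>1 / m y\<bar> * dist (m x) (m y)"
      by (simp only: abs_mult dist_real_def abs_minus_commute)
    also have "\<dots> \<le> A * A * (L * dist x y)"
      using A xyz L lipschitz_onD[OF m xyz(1,2)] by (intro mult_mono) auto
    also have "\<dots> \<le> A * A * ((L + 1) * dist x y) * 1"
      using A(1) by (auto intro!: mult_left_mono mult_right_mono)
    also have "\<dots> \<le> A * A * ((L + 1) * dist x y) * (B * \<bar>1 / m z\<bar>)"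
      using A(1) B(2)[OF xyz(3)] m0[OF xyz(3)] L by (intro mult_left_mono) (auto simp: field_simps)
    finally show "\<bar>1 / m x - 1 / m y\<bar> \<le> K * \<bar>1 / m z\<bar> * dist x y" by (simp add: K_def mult_ac)
  qed
  moreover have "K > 0" using A(1) B(1) L by (simp add: K_def)
  ultimately show ?thesis by blast
qed

section \<open>Measures of sets with thin slices\<close>

lemma emeasure_lborel_le_of_diameter:
  fixes A :: "real set"
  assumes "l \<ge> 0" and diameter: "\<And>y z. y \<in> A \<Longrightarrow> z \<in> A \<Longrightarrow> \<bar>y - z\<bar> \<le> l"
  shows "emeasure lborel A \<le> ennreal l"
proof (cases "A = {}")
  case False
  then obtain z where "z \<in> A" by blast
  then have bdd: "bdd_below A"
    using diameter[of z] by (intro bdd_belowI[of _ "z - l"]) (auto simp: abs_le_iff algebra_simps)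
  have "A \<subseteq> {Inf A..Inf A + l}"
  proof
    fix y assume y: "y \<in> A"
    have "y - l \<le> Inf A"
      using diameter[OF y] False by (intro cInf_greatest) (auto simp: abs_le_iff algebra_simps)
    then show "y \<in> {Inf A..Inf A + l}" using cInf_lower[OF y bdd] by auto
  qed
  then have "emeasure lborel A \<le> emeasure lborel {Inf A..Inf A + l}" by (rule emeasure_mono) simp
  then show ?thesis using \<open>l \<ge> 0\<close> by simp
qed simp

lemma emeasure_lborel_slices:
  fixes E :: "'a::euclidean_space set"
  assumes E [measurable]: "E \<in> sets borel" and b: "b \<in> Basis"
  shows "emeasure lborel E =
    (\<integral>\<^sup>+ f. emeasure lborel {y. y *\<^sub>R b + (\<Sum>c\<in>Basis - {b}. f c *\<^sub>R c) \<in> E}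
      \<partial>(\<Pi>\<^sub>M c\<in>Basis - {b}. lborel))"
proof -
  let ?I = "Basis - {b}"
  interpret product_sigma_finite "\<lambda>_::'a. lborel :: real measure" by standard
  define P :: "('a \<Rightarrow> real) \<Rightarrow> 'a" where "P f = (\<Sum>c\<in>Basis. f c *\<^sub>R c)" for f
  have [measurable]: "P \<in> measurable (Pi\<^sub>M Basis (\<lambda>_. lborel)) borel"
    unfolding P_def by measurable
  have Basis: "insert b ?I = Basis" using b by auto
  have P_upd: "P (f(b := y)) = y *\<^sub>R b + (\<Sum>c\<in>?I. f c *\<^sub>R c)" for f y
    unfolding P_def by (subst sum.remove[OF _ b]) (auto intro!: sum.cong)
  have "emeasure lborel E = emeasure (distr (Pi\<^sub>M Basis (\<lambda>_. lborel)) borel P) E"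
    using lborel_eq[where 'a='a] by (simp add: P_def[abs_def])
  also have "\<dots> = (\<integral>\<^sup>+ x. indicator E x \<partial>(distr (Pi\<^sub>M Basis (\<lambda>_. lborel)) borel P))"
    using E by simp
  also have "\<dots> = (\<integral>\<^sup>+ f. indicator E (P f) \<partial>(Pi\<^sub>M (insert b ?I) (\<lambda>_. lborel)))"
    unfolding Basis by (subst nn_integral_distr) auto
  also have "\<dots> = (\<integral>\<^sup>+ f. (\<integral>\<^sup>+ y. indicator E (P (f(b := y))) \<partial>lborel) \<partial>(Pi\<^sub>M ?I (\<lambda>_. lborel)))"
  proof (rule product_nn_integral_insert)
    show "(\<lambda>f. indicator E (P f)) \<in> borel_measurable (Pi\<^sub>M (insert b ?I) (\<lambda>_. lborel))"
      unfolding Basis by measurable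
  qed auto
  also have "(\<lambda>f. \<integral>\<^sup>+ y. indicator E (P (f(b := y))) \<partial>lborel) =
      (\<lambda>f. emeasure lborel {y. y *\<^sub>R b + (\<Sum>c\<in>?I. f c *\<^sub>R c) \<in> E})"
  proof
    fix f :: "'a \<Rightarrow> real"
    let ?A = "{y. y *\<^sub>R b + (\<Sum>c\<in>?I. f c *\<^sub>R c) \<in> E}"
    have "(\<integral>\<^sup>+ y. indicator E (P (f(b := y))) \<partial>lborel) = (\<integral>\<^sup>+ y. indicator ?A y \<partial>lborel)"
      by (intro nn_integral_cong) (simp add: P_upd indicator_def)
    also have "\<dots> = emeasure lborel ?A" by (rule nn_integral_indicator) measurable
    finally show "(\<integral>\<^sup>+ y. indicator E (P (f(b := y))) \<partial>lborel) = emeasure lborel ?A" .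
  qed
  finally show ?thesis .
qed

lemma L2_norm_other_coordinates_le:
  fixes b :: "'a::euclidean_space"
  assumes b: "b \<in> Basis"
  shows "sqrt (\<Sum>c\<in>Basis - {b}. (f c)\<^sup>2) \<le> norm (y *\<^sub>R b + (\<Sum>c\<in>Basis - {b}. f c *\<^sub>R c))"
proof -
  let ?x = "y *\<^sub>R b + (\<Sum>c\<in>Basis - {b}. f c *\<^sub>R c)"
  have "?x \<bullet> c = f c" if "c \<in> Basis - {b}" for c
    using that b by (auto simp: inner_add_left inner_sum_left inner_Basis if_distrib cong: if_cong)
  then have "(\<Sum>c\<in>Basis - {b}. (f c)\<^sup>2) = (\<Sum>c\<in>Basis - {b}. (?x \<bullet> c)\<^sup>2)" by simp
  also have "\<dots> \<le> (\<Sum>c\<in>Basis. (?x \<bullet> c)\<^sup>2)" by (intro sum_mono2) auto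
  also have "\<dots> = (norm ?x)\<^sup>2"
    unfolding power2_norm_eq_inner euclidean_inner[of ?x ?x] by (simp add: power2_eq_square)
  finally show ?thesis by (simp add: real_le_lsqrt)
qed

lemma emeasure_le_of_thin_slices:
  fixes E :: "'a::euclidean_space set"
  assumes E: "E \<in> sets borel" "E \<subseteq> ball 0 R" and R: "R > 0" and b: "b \<in> Basis" and l: "l \<ge> 0"
    and slice: "\<And>p t. p \<in> E \<Longrightarrow> p + t *\<^sub>R b \<in> E \<Longrightarrow> \<bar>t\<bar> \<le> l"
  shows "emeasure lborel E \<le> ennreal (l * (unit_ball_vol (real DIM('a) - 1) * R ^ (DIM('a) - 1)))"
proof -
  let ?I = "Basis - {b}"
  let ?M = "\<Pi>\<^sub>M c\<in>?I. lborel :: real measure"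
  define shadow where "shadow = {f. sqrt (\<Sum>c\<in>?I. (f c)\<^sup>2) \<le> R} \<inter> space ?M"
  define chord where "chord f = {y. y *\<^sub>R b + (\<Sum>c\<in>?I. f c *\<^sub>R c) \<in> E}" for f
  have "emeasure lborel (chord f) \<le> ennreal l * indicator shadow f" if "f \<in> space ?M" for f
  proof (cases "chord f = {}")
    case False
    then obtain y where "y *\<^sub>R b + (\<Sum>c\<in>?I. f c *\<^sub>R c) \<in> E" by (auto simp: chord_def)
    then have "sqrt (\<Sum>c\<in>?I. (f c)\<^sup>2) \<le> R"
      using L2_norm_other_coordinates_le[OF b, of f y] E(2) by force
    then have "f \<in> shadow" using that by (simp add: shadow_def)
    moreover have "emeasure lborel (chord f) \<le> ennreal l"
    proof (rule emeasure_lborel_le_of_diameter[OF l])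
      fix y z assume "y \<in> chord f" "z \<in> chord f"
      then show "\<bar>y - z\<bar> \<le> l"
        using slice[of "z *\<^sub>R b + (\<Sum>c\<in>?I. f c *\<^sub>R c)" "y - z"]
        by (simp add: chord_def algebra_simps)
    qed
    ultimately show ?thesis by simp
  qed simp
  then have "emeasure lborel E \<le> (\<integral>\<^sup>+ f. ennreal l * indicator shadow f \<partial>?M)"
    unfolding emeasure_lborel_slices[OF E(1) b] chord_def[symmetric] by (rule nn_integral_mono)
  also have "\<dots> = ennreal l * emeasure ?M shadow"
    unfolding shadow_def by (rule nn_integral_cmult_indicator) measurable
  also have "emeasure ?M shadow = ennreal (unit_ball_vol (real (card ?I)) * R ^ card ?I)"
    unfolding shadow_def by (rule emeasure_cball_aux) (use R in auto)
  also have "card ?I = DIM('a) - 1" using b by simp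
  also have "real (DIM('a) - 1) = real DIM('a) - 1"
    using DIM_positive[where 'a='a] by (simp add: of_nat_diff)
  finally show ?thesis using l by (simp add: ennreal_mult')
qed

theorem measure_le_of_thin_slices:
  fixes E :: "'a::euclidean_space set"
  assumes E: "E \<in> sets borel" "E \<subseteq> ball x R" and R: "R > 0" and b: "b \<in> Basis" and l: "l \<ge> 0"
    and slice: "\<And>p t. p \<in> E \<Longrightarrow> p + t *\<^sub>R b \<in> E \<Longrightarrow> \<bar>t\<bar> \<le> l"
  shows "measure lebesgue E \<le> l * (unit_ball_vol (real DIM('a) - 1) * R ^ (DIM('a) - 1))"
proof -
  let ?F = "(\<lambda>p. - x + p) ` E" and ?v = "l * (unit_ball_vol (real DIM('a) - 1) * R ^ (DIM('a) - 1))"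
  have F: "?F = (\<lambda>p. x + p) -` E" by (force simp: image_iff)
  have borel: "?F \<in> sets borel"
    unfolding F using measurable_sets[of "\<lambda>p. x + p" borel borel E] E(1) by simp
  then have "emeasure lborel ?F \<le> ennreal ?v"
  proof (rule emeasure_le_of_thin_slices[OF _ _ R b l])
    show "?F \<subseteq> ball 0 R" using E(2) by (auto simp: dist_norm norm_minus_commute)
    show "\<bar>t\<bar> \<le> l" if "p \<in> ?F" "p + t *\<^sub>R b \<in> ?F" for p t
      using that slice[of "x + p" t] unfolding F by (simp add: algebra_simps)
  qed
  moreover have "0 \<le> ?v"
    using l R DIM_positive[where 'a='a] by (intro mult_nonneg_nonneg unit_ball_vol_nonneg) auto
  ultimately have "measure lborel ?F \<le> ?v" by (simp add: measure_def enn2real_leI)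
  moreover have "measure lebesgue E = measure lborel ?F"
    using measure_translation[of "- x" E] borel by (simp add: measure_completion)
  ultimately show ?thesis by simp
qed

lemma sum_measure_le_of_card_le:
  assumes "finite I" and A: "\<And>i. i \<in> I \<Longrightarrow> A i \<in> fmeasurable M" "\<And>i. i \<in> I \<Longrightarrow> A i \<subseteq> B"
    and B: "B \<in> fmeasurable M" and card: "\<And>p. card {i \<in> I. p \<in> A i} \<le> m"
  shows "(\<Sum>i\<in>I. measure M (A i)) \<le> real m * measure M B"
proof -
  have int: "integrable M (indicat_real X)" "(\<integral>p. indicat_real X p \<partial>M) = measure M X"
    if "X \<in> fmeasurable M" for X
    using that fmeasurableD[OF that] by (auto simp: fmeasurable_def)
  have "(\<Sum>i\<in>I. measure M (A i)) = (\<integral>p. (\<Sum>i\<in>I. indicat_real (A i) p) \<partial>M)"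
    using A int by (subst Bochner_Integration.integral_sum) auto
  also have "\<dots> \<le> (\<integral>p. real m * indicat_real B p \<partial>M)"
  proof (rule integral_mono)
    show "(\<Sum>i\<in>I. indicat_real (A i) p) \<le> real m * indicat_real B p" for p
    proof (cases "p \<in> B")
      case True
      have "(\<Sum>i\<in>I. indicat_real (A i) p) = real (card {i \<in> I. p \<in> A i})"
        using \<open>finite I\<close> by (simp add: indicator_def sum.If_cases Int_def)
      then show ?thesis using True card by simp
    next
      case False
      then have "(\<Sum>i\<in>I. indicat_real (A i) p) = 0"
        using A(2) by (intro sum.neutral) (auto simp: indicator_def)
      then show ?thesis using False by simp
    qed
  qed (use A B int in auto)
  also have "\<dots> = real m * measure M B" using B int by simp
  finally show ?thesis .
qed

lemma sum_measure_le_of_overlap: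
  assumes I: "finite I" and A: "\<And>i. i \<in> I \<Longrightarrow> A i \<in> fmeasurable M"
    and N: "N \<in> fmeasurable M" and F: "F \<in> fmeasurable M" and cover: "\<And>i. i \<in> I \<Longrightarrow> A i \<subseteq> N \<union> F"
    and card: "\<And>p. card {i \<in> I. p \<in> A i} \<le> m" "\<And>p. card {i \<in> I. p \<in> A i - N} \<le> l"
  shows "(\<Sum>i\<in>I. measure M (A i)) \<le> real m * measure M N + real l * measure M F"
proof -
  have fm: "A i \<inter> N \<in> fmeasurable M" "A i - N \<in> fmeasurable M" if "i \<in> I" for i
    using A[OF that] N by (rule fmeasurable.Int fmeasurable.Diff)+
  have "measure M (A i) = measure M (A i \<inter> N) + measure M (A i - N)" if "i \<in> I" for i
    using measure_Un2[OF fm(1) A, OF that that]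
    by (simp only: Un_absorb1[OF Int_lower1] Diff_Int Diff_cancel Un_empty_left)
  then have "(\<Sum>i\<in>I. measure M (A i)) = (\<Sum>i\<in>I. measure M (A i \<inter> N)) + (\<Sum>i\<in>I. measure M (A i - N))"
    by (simp add: sum.distrib)
  also have "\<dots> \<le> real m * measure M N + real l * measure M F"
  proof (intro add_mono sum_measure_le_of_card_le I fm N F card(2))
    show "card {i \<in> I. p \<in> A i \<inter> N} \<le> m" for p
      by (rule order_trans[OF card_mono card(1)[of p]]) (use I in auto)
  qed (use cover in auto)
  finally show ?thesis .
qed

lemma card_le_2_of_consecutive:
  fixes X :: "int set"
  assumes "finite X" and "\<And>i j. i \<in> X \<Longrightarrow> j \<in> X \<Longrightarrow> i < j \<Longrightarrow> j \<le> i + 1"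
  shows "card X \<le> 2"
proof (cases "X = {}")
  case False
  then have "X \<subseteq> {Min X, Min X + 1}"
    using assms(2)[OF Min_in[OF assms(1) False]] Min_le[OF assms(1)] by (force simp: le_less)
  then have "card X \<le> card {Min X, Min X + 1}" by (intro card_mono) auto
  then show ?thesis by simp
qed simp

section \<open>The threshold for \<open>\<sigma>\<close>\<close>

lemma eta0_strict_antimono:
  assumes "k \<ge> 1" "Y > 0" "1 < s" "s < t"
  shows "eta0 k t Y < eta0 k s Y"
proof -
  have "sqrt s < sqrt t" "1 < sqrt s" using assms by auto
  moreover have "0 < Y * (unit_ball_vol (real k - 1) / unit_ball_vol (real k))"
    using assms by (intro mult_pos_pos divide_pos_pos unit_ball_vol_pos) auto
  moreover have "t powr (-1/2) < s powr (-1/2)" using assms by (intro powr_less_mono2_neg) auto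
  moreover have "4 / (sqrt t - 1) < 4 / (sqrt s - 1)" using calculation by (simp add: field_simps)
  ultimately show ?thesis unfolding eta0_def mult.assoc
    by (intro add_strict_mono mult_strict_right_mono)
qed

lemma powr_minus_half: "s > 0 \<Longrightarrow> s powr (-1/2) = 1 / sqrt s"
  by (simp add: powr_half_sqrt[symmetric] powr_minus_divide)

text \<open>In terms of \<open>t = sqrt s\<close> the equation reads \<open>1 / t + c / (t - 1) = 1\<close>, that is
  \<open>t\<^sup>2 - (2 + c) t + 1 = 0\<close>.\<close>

lemma ex_eta0_eq_1:
  assumes "k \<ge> 1" "Y > 0"
  shows "\<exists>s>1. eta0 k s Y = 1"
proof -
  define c where "c = 4 * (Y * (unit_ball_vol (real k - 1) / unit_ball_vol (real k)))"
  have c: "c > 0"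
    unfolding c_def using assms by (intro mult_pos_pos divide_pos_pos unit_ball_vol_pos) auto
  define q where "q = sqrt ((2 + c)\<^sup>2 - 4)"
  have "(2 + c)\<^sup>2 - 4 \<ge> 0" using c by (simp add: power2_eq_square algebra_simps)
  then have q: "q \<ge> 0" "q\<^sup>2 = (2 + c)\<^sup>2 - 4" by (simp_all add: q_def)
  define t where "t = (2 + c + q) / 2"
  have t: "t > 1" unfolding t_def using q(1) c by simp
  have "t * t - (2 + c) * t + 1 = (q\<^sup>2 - ((2 + c)\<^sup>2 - 4)) / 4"
    unfolding t_def by (simp add: power2_eq_square field_simps)
  then have "t * t - (2 + c) * t + 1 = 0" using q(2) by simp
  then have "1 / t + c / (t - 1) = 1" using t by (simp add: field_simps)
  moreover have "t\<^sup>2 powr (-1/2) = 1 / t" using powr_minus_half[of "t\<^sup>2"] t by simp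
  ultimately have "eta0 k (t\<^sup>2) Y = 1" using t by (simp add: eta0_def c_def mult_ac)
  moreover have "t\<^sup>2 > 1" using t by (simp add: one_less_power)
  ultimately show ?thesis by blast
qed

lemma Sk_less_imp:
  assumes "k \<ge> 1" "Y > 0" "\<sigma> > Sk k Y"
  shows "\<sigma> > 1" "eta0 k \<sigma> Y < 1"
proof -
  note antimono = eta0_strict_antimono[OF assms(1,2)]
  obtain s where s: "s > 1" "eta0 k s Y = 1" using ex_eta0_eq_1[OF assms(1,2)] by blast
  have "Sk k Y = s"
    unfolding Sk_def
  proof (rule the_equality)
    fix r assume r: "r > 1 \<and> eta0 k r Y = 1"
    then show "r = s" using antimono[of r s] antimono[of s r] s
      by (cases r s rule: linorder_cases) auto
  qed (use s in simp)
  then show "\<sigma> > 1" "eta0 k \<sigma> Y < 1" using assms(3) s antimono[of s \<sigma>] by auto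
qed

section \<open>Expansion of the delay map\<close>

lemma bij_betw_crd: "bij_betw crd {..<CARD('n)} (UNIV :: 'n::{finite,linorder} set)"
  unfolding crd_def by (rule bij_betw_nth) auto

lemma crd_less_iff:
  assumes "p < CARD('n)" "q < CARD('n)"
  shows "(crd p :: 'n::{finite,linorder}) < crd q \<longleftrightarrow> p < q"
proof -
  have mono: "(crd p :: 'n) < crd q" if "p < q" "q < CARD('n)" for p q
    unfolding crd_def using that by (intro sorted_wrt_nth_less[of "(<)"]) auto
  show ?thesis using mono[of p q] mono[of q p] assms by (cases p q rule: linorder_cases) auto
qed

lemma pos_crd:
  assumes p: "p < CARD('n)"
  shows "pos (crd p :: 'n::{finite,linorder}) = p"
proof -
  have "{j :: 'n. j < crd p} = crd ` {..<p}"
  proof (intro equalityI subsetI)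
    fix j :: 'n assume j: "j \<in> {j. j < crd p}"
    obtain q where "q < CARD('n)" "j = crd q"
      using bij_betw_crd[where 'n='n] by (auto simp: bij_betw_def)
    then show "j \<in> crd ` {..<p}" using j p by (auto simp: crd_less_iff)
  qed (use p in \<open>auto simp: crd_less_iff\<close>)
  moreover have "inj_on (crd :: nat \<Rightarrow> 'n) {..<p}"
    by (rule inj_on_subset[OF bij_betw_imp_inj_on[OF bij_betw_crd]]) (use p in auto)
  ultimately show ?thesis by (simp add: pos_def card_image)
qed

lemma
  fixes i :: "'n::{finite,linorder}"
  shows crd_pos: "crd (pos i) = i" and pos_less: "pos i < CARD('n)"
proof -
  obtain p where "p < CARD('n)" "i = crd p"
    using bij_betw_crd[where 'n='n] by (auto simp: bij_betw_def)
  then show "crd (pos i) = i" "pos i < CARD('n)" by (simp_all add: pos_crd)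
qed

lemma sum_UNIV_crd:
  "(\<Sum>i\<in>(UNIV :: 'n::{finite,linorder} set). f i) = (\<Sum>p<CARD('n). f (crd p))"
  by (rule sum.reindex_bij_betw[OF bij_betw_crd, symmetric])

lemma power2_norm_crd:
  fixes x :: "real^('n::{finite,linorder})"
  shows "(norm x)\<^sup>2 = (\<Sum>p<CARD('n). (x $ crd p)\<^sup>2)"
  by (simp add: norm_vec_def L2_set_def sum_nonneg sum_UNIV_crd)

lemma frechet_derivative_eq_sum_partial:
  fixes \<Phi> :: "real^('n::{finite,linorder}) \<Rightarrow> real"
  assumes "\<Phi> differentiable (at x)"
  shows "frechet_derivative \<Phi> (at x) h = (\<Sum>p<CARD('n). partial \<Phi> p x * h $ crd p)"
proof -
  have lin: "linear (frechet_derivative \<Phi> (at x))" by (rule linear_frechet_derivative[OF assms])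
  have "frechet_derivative \<Phi> (at x) h = frechet_derivative \<Phi> (at x) (\<Sum>i\<in>UNIV. h $ i *\<^sub>R axis i 1)"
    using basis_expansion[of h] by (simp add: scalar_mult_eq_scaleR)
  also have "\<dots> = (\<Sum>i\<in>UNIV. h $ i * frechet_derivative \<Phi> (at x) (axis i 1))"
    by (simp add: linear_sum[OF lin] linear_cmul[OF lin])
  finally show ?thesis by (simp add: sum_UNIV_crd partial_def mult.commute)
qed

lemma mvt_convex:
  fixes f :: "'a::real_normed_vector \<Rightarrow> real"
  assumes S: "convex S" "x \<in> S" "y \<in> S" and f: "\<And>z. z \<in> S \<Longrightarrow> f differentiable (at z)"
  obtains z where "z \<in> S" "f y - f x = frechet_derivative f (at z) (y - x)"
proof -
  define p where "p t = x + t *\<^sub>R (y - x)" for t :: real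
  have p: "p t \<in> S" if "t \<in> {0..1}" for t
    using convexD_alt[OF S, of t] that by (simp add: p_def algebra_simps)
  have "\<exists>t\<in>{0<..<1}. f (p 1) - f (p 0) =
      (\<lambda>s. frechet_derivative f (at (p t)) (s *\<^sub>R (y - x))) (1 - 0)"
  proof (rule mvt_simple)
    fix t :: real assume t: "0 \<le> t" "t \<le> 1"
    have "(p has_derivative (\<lambda>s. s *\<^sub>R (y - x))) (at t within {0..1})"
      unfolding p_def by (auto intro!: derivative_eq_intros)
    moreover have "(f has_derivative frechet_derivative f (at (p t))) (at (p t))"
      using f[OF p] t by (simp flip: frechet_derivative_works)
    ultimately show "((\<lambda>t. f (p t)) has_derivative
        (\<lambda>s. frechet_derivative f (at (p t)) (s *\<^sub>R (y - x)))) (at t within {0..1})"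
      by (rule has_derivative_compose)
  qed simp
  then obtain t where "t \<in> {0<..<1}" "f y - f x = frechet_derivative f (at (p t)) (y - x)"
    by (auto simp: p_def)
  then show ?thesis using that[OF p[of t]] by simp
qed

lemma linear_Gam: "linear (Gam \<gamma>)"
  by (rule linearI) (auto simp: Gam_def vec_eq_iff add_divide_distrib)

lemma convex_ocube: "convex (ocube r :: (real^'n) set)"
proof -
  have "(ocube r :: (real^'n) set) = box (\<chi> i. - r) (\<chi> i. r)"
    unfolding set_eq_iff ocube_def mem_box_cart abs_less_iff
    by (simp add: minus_less_iff conj_commute)
  then show ?thesis by simp
qed

text \<open>The weights \<open>1 / C2\<close> and \<open>1 / (C2 - 1)\<close> below come from
  \<open>(p + w)\<^sup>2 \<ge> (1 - t) p\<^sup>2 - (1 / t - 1) w\<^sup>2\<close> with \<open>t = (C2 - 1) / C2\<close>.\<close>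

lemma expansion_inequality:
  fixes h a :: "nat \<Rightarrow> real"
  assumes s: "s > 0" and C: "C1 > 1" "C2 > 1"
    and a0: "(a 0)\<^sup>2 \<ge> C2 * s"
    and a: "\<And>p. p < m \<Longrightarrow> (a (Suc p))\<^sup>2 \<le> (C1 - 1) * (C2 - 1) / real m * s"
  shows "s * (\<Sum>p<Suc m. (h p)\<^sup>2) \<le> C1 * s * (\<Sum>p<m. (h (Suc p))\<^sup>2) + (\<Sum>p<Suc m. a p * h p)\<^sup>2"
proof -
  define H where "H = (\<Sum>p<m. (h (Suc p))\<^sup>2)"
  define w where "w = (\<Sum>p<m. a (Suc p) * h (Suc p))"
  define q where "q = a 0 * h 0"
  have H: "H \<ge> 0" unfolding H_def by (simp add: sum_nonneg)
  have "(\<Sum>p<m. (a (Suc p))\<^sup>2) \<le> (\<Sum>p<m. (C1 - 1) * (C2 - 1) / real m * s)"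
    using a by (intro sum_mono) auto
  also have "\<dots> \<le> (C1 - 1) * (C2 - 1) * s" using C s by (cases "m = 0") auto
  finally have "w\<^sup>2 \<le> (C1 - 1) * (C2 - 1) * s * H"
    using Cauchy_Schwarz_ineq_sum[of "\<lambda>p. a (Suc p)" "\<lambda>p. h (Suc p)" "{..<m}"] H
    unfolding w_def H_def by (meson mult_right_mono order_trans)
  then have w: "w\<^sup>2 / (C2 - 1) \<le> (C1 - 1) * s * H"
    using C by (simp add: field_simps)
  have "C2 * s * (h 0)\<^sup>2 \<le> q\<^sup>2"
    using mult_right_mono[OF a0, of "(h 0)\<^sup>2"] by (simp add: q_def power_mult_distrib)
  then have q: "s * (h 0)\<^sup>2 \<le> q\<^sup>2 / C2" using C by (simp add: field_simps)
  have "0 \<le> ((C2 - 1) * q + C2 * w)\<^sup>2 / (C2 * (C2 - 1))" using C by simp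
  also have "\<dots> = (q + w)\<^sup>2 - (q\<^sup>2 / C2 - w\<^sup>2 / (C2 - 1))"
    using C by (simp add: divide_simps) (simp add: power2_eq_square algebra_simps)
  finally have "(q + w)\<^sup>2 \<ge> s * (h 0)\<^sup>2 - (C1 - 1) * s * H" using w q by simp
  moreover have "(\<Sum>p<Suc m. a p * h p) = q + w" "(\<Sum>p<Suc m. (h p)\<^sup>2) = (h 0)\<^sup>2 + H"
    unfolding q_def w_def H_def by (simp_all only: sum.lessThan_Suc_shift)
  ultimately show ?thesis unfolding H_def[symmetric] by (simp add: algebra_simps)
qed

locale steep_potential =
  fixes \<Phi>0 :: "real^('n::{finite,linorder}) \<Rightarrow> real" and r \<sigma> C1 C2 \<gamma> :: real
  assumes k2: "CARD('n) \<ge> 2"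
    and differentiable: "x \<in> ocube r \<Longrightarrow> \<Phi>0 differentiable (at x)"
    and \<sigma>: "\<sigma> > 1" and C1: "C1 > 1" and C2: "C2 > 1"
    and \<gamma>: "\<gamma> > 0" "1 / \<gamma>\<^sup>2 = C1 * \<sigma>"
    and partial_0_ge: "x \<in> ocube r \<Longrightarrow> (partial \<Phi>0 0 x)\<^sup>2 \<ge> C1 ^ (CARD('n) - 1) * C2 * \<sigma> ^ CARD('n)"
    and partial_le: "x \<in> ocube r \<Longrightarrow> 1 \<le> p \<Longrightarrow> p < CARD('n) \<Longrightarrow>
      (partial \<Phi>0 p x)\<^sup>2 \<le> (C1 - 1) * (C2 - 1) / (real CARD('n) - 1) * \<sigma>"
begin

definition last_pos :: nat where "last_pos = CARD('n) - 1"

definition scaled_partial :: "nat \<Rightarrow> (real, 'n) vec \<Rightarrow> real" where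
  "scaled_partial p x = \<gamma> ^ (last_pos - p) * partial \<Phi>0 p x"

lemma card_eq: "CARD('n) = Suc last_pos"
  using k2 by (simp add: last_pos_def)

lemma \<gamma>_less_1: "\<gamma> < 1"
proof -
  have "1 < 1 / \<gamma>\<^sup>2" using C1 \<sigma> by (simp add: \<gamma>(2) less_1_mult)
  then have "\<gamma>\<^sup>2 < 1\<^sup>2" using \<gamma>(1) by simp
  then show ?thesis by (rule power2_less_imp_less) simp
qed

lemma scaled_partial_0_ge:
  assumes "x \<in> ocube r" shows "C2 * \<sigma> \<le> (scaled_partial 0 x)\<^sup>2"
proof -
  have "\<gamma>\<^sup>2 * (C1 * \<sigma>) = 1" using \<gamma>(1) by (simp flip: \<gamma>(2))
  then have "C2 * \<sigma> = (\<gamma>\<^sup>2 * (C1 * \<sigma>)) ^ last_pos * (C2 * \<sigma>)" by simp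
  also have "\<dots> = (\<gamma>\<^sup>2) ^ last_pos * (C1 ^ last_pos * C2 * \<sigma> ^ Suc last_pos)"
    by (simp add: power_mult_distrib mult_ac)
  also have "\<dots> \<le> (\<gamma>\<^sup>2) ^ last_pos * (partial \<Phi>0 0 x)\<^sup>2"
    using partial_0_ge[OF assms] by (intro mult_left_mono) (simp_all add: card_eq)
  also have "\<dots> = (scaled_partial 0 x)\<^sup>2"
    by (simp add: scaled_partial_def power_mult_distrib mult.commute flip: power_mult)
  finally show ?thesis .
qed

lemma scaled_partial_Suc_le:
  assumes "x \<in> ocube r" "p < last_pos"
  shows "(scaled_partial (Suc p) x)\<^sup>2 \<le> (C1 - 1) * (C2 - 1) / real last_pos * \<sigma>"
proof -
  have "(scaled_partial (Suc p) x)\<^sup>2 \<le> 1 * (partial \<Phi>0 (Suc p) x)\<^sup>2"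
    unfolding scaled_partial_def power_mult_distrib using \<gamma>(1) \<gamma>_less_1
    by (intro mult_right_mono) (auto simp: abs_square_le_1 power_le_one)
  then show ?thesis using partial_le[OF assms(1), of "Suc p"] assms(2) by (simp add: card_eq)
qed

lemma scaled_mean_value:
  assumes "Gam \<gamma> u \<in> ocube r" "Gam \<gamma> v \<in> ocube r"
  obtains \<xi> where "\<xi> \<in> ocube r"
    "\<gamma> ^ last_pos * (\<Phi>0 (Gam \<gamma> u) - \<Phi>0 (Gam \<gamma> v))
        = (\<Sum>p<Suc last_pos. scaled_partial p \<xi> * (u - v) $ crd p)"
proof -
  obtain \<xi> where \<xi>: "\<xi> \<in> ocube r"
    "\<Phi>0 (Gam \<gamma> u) - \<Phi>0 (Gam \<gamma> v) = frechet_derivative \<Phi>0 (at \<xi>) (Gam \<gamma> u - Gam \<gamma> v)"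
    using mvt_convex[OF convex_ocube assms(2,1) differentiable] .
  have "\<gamma> ^ last_pos * (\<Phi>0 (Gam \<gamma> u) - \<Phi>0 (Gam \<gamma> v))
      = \<gamma> ^ last_pos * frechet_derivative \<Phi>0 (at \<xi>) (Gam \<gamma> (u - v))"
    by (simp add: \<xi>(2) linear_diff[OF linear_Gam])
  also have "\<dots> = (\<Sum>p<Suc last_pos. \<gamma> ^ last_pos * (partial \<Phi>0 p \<xi> * Gam \<gamma> (u - v) $ crd p))"
    unfolding frechet_derivative_eq_sum_partial[OF differentiable[OF \<xi>(1)]] card_eq
      sum_distrib_left ..
  also have "\<dots> = (\<Sum>p<Suc last_pos. scaled_partial p \<xi> * (u - v) $ crd p)"
  proof (rule sum.cong[OF refl])
    fix p assume "p \<in> {..<Suc last_pos}"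
    then have "pos (crd p :: 'n) = p" "\<gamma> ^ last_pos = \<gamma> ^ (last_pos - p) * \<gamma> ^ p"
      by (simp_all add: pos_crd card_eq flip: power_add)
    then show "\<gamma> ^ last_pos * (partial \<Phi>0 p \<xi> * Gam \<gamma> (u - v) $ crd p)
        = scaled_partial p \<xi> * (u - v) $ crd p"
      using \<gamma>(1) by (simp add: Gam_def scaled_partial_def)
  qed
  finally show ?thesis using that \<xi>(1) by blast
qed

lemma power2_norm_Smap_diff:
  "(norm (Smap \<gamma> \<Phi>0 u - Smap \<gamma> \<Phi>0 v))\<^sup>2 =
    C1 * \<sigma> * (\<Sum>p<last_pos. ((u - v) $ crd (Suc p))\<^sup>2) +
      (\<gamma> ^ last_pos * (\<Phi>0 (Gam \<gamma> u) - \<Phi>0 (Gam \<gamma> v)))\<^sup>2"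
proof -
  let ?w = "Smap \<gamma> \<Phi>0 u - Smap \<gamma> \<Phi>0 v"
  have shifted: "?w $ crd p = (u - v) $ crd (Suc p) / \<gamma>" if "p < last_pos" for p
    using that by (simp add: Smap_def pos_crd card_eq diff_divide_distrib)
  have last_coord: "?w $ crd last_pos = \<gamma> ^ last_pos * (\<Phi>0 (Gam \<gamma> u) - \<Phi>0 (Gam \<gamma> v))"
    by (simp add: Smap_def pos_crd card_eq right_diff_distrib)
  have "(norm ?w)\<^sup>2 = (\<Sum>p<last_pos. (?w $ crd p)\<^sup>2) + (?w $ crd last_pos)\<^sup>2"
    by (simp add: power2_norm_crd card_eq)
  also have "(\<Sum>p<last_pos. (?w $ crd p)\<^sup>2) = (\<Sum>p<last_pos. C1 * \<sigma> * ((u - v) $ crd (Suc p))\<^sup>2)"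
    using shifted by (intro sum.cong) (auto simp: power_divide simp flip: \<gamma>(2))
  finally show ?thesis unfolding last_coord sum_distrib_left .
qed

theorem expanding_on_Smap: "expanding_on (sqrt \<sigma>) {u. Gam \<gamma> u \<in> ocube r} (Smap \<gamma> \<Phi>0)"
proof (rule expanding_onI)
  fix u v :: "(real, 'n) vec"
  assume "u \<in> {u. Gam \<gamma> u \<in> ocube r}" "v \<in> {u. Gam \<gamma> u \<in> ocube r}"
  then obtain \<xi> where \<xi>: "\<xi> \<in> ocube r"
    "\<gamma> ^ last_pos * (\<Phi>0 (Gam \<gamma> u) - \<Phi>0 (Gam \<gamma> v))
        = (\<Sum>p<Suc last_pos. scaled_partial p \<xi> * (u - v) $ crd p)"
    using scaled_mean_value by blast
  have "\<sigma> * (norm (u - v))\<^sup>2 \<le> (norm (Smap \<gamma> \<Phi>0 u - Smap \<gamma> \<Phi>0 v))\<^sup>2"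
    unfolding power2_norm_Smap_diff power2_norm_crd[of "u - v"] card_eq \<xi>(2)
    using \<sigma> by (intro expansion_inequality[OF _ C1 C2 scaled_partial_0_ge scaled_partial_Suc_le]
      \<xi>(1)) auto
  then have "(sqrt \<sigma> * norm (u - v))\<^sup>2 \<le> (norm (Smap \<gamma> \<Phi>0 u - Smap \<gamma> \<Phi>0 v))\<^sup>2"
    using \<sigma> by (simp add: power_mult_distrib)
  then show "sqrt \<sigma> * dist u v \<le> dist (Smap \<gamma> \<Phi>0 u) (Smap \<gamma> \<Phi>0 v)"
    unfolding dist_norm by (rule power2_le_imp_le) simp
qed

end

section \<open>Boxes and branches\<close>

lemma mem_Omega_iff:
  assumes "\<gamma> > 0" shows "x \<in> Omega \<gamma> L \<longleftrightarrow> (\<forall>i. \<bar>x $ i\<bar> \<le> L * \<gamma> ^ pos i)"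
  using assms by (simp add: Omega_def ccube_def Gam_def pos_divide_le_eq)

lemma mem_Omega_r_iff:
  assumes "\<gamma> > 0" shows "x \<in> Omega_r \<gamma> L r \<longleftrightarrow> (\<forall>i. \<bar>x $ i\<bar> < (L + r) * \<gamma> ^ pos i)"
  using assms by (simp add: Omega_r_def ocube_def Gam_def pos_divide_less_eq)

lemma Omega_eq_cbox:
  assumes "\<gamma> > 0"
  shows "(Omega \<gamma> L :: (real^('n::{finite,linorder})) set)
      = cbox (\<chi> i. - (L * \<gamma> ^ pos i)) (\<chi> i. L * \<gamma> ^ pos i)"
  unfolding set_eq_iff mem_Omega_iff[OF assms] mem_box_cart vec_lambda_beta abs_le_iff
  by (metis minus_le_iff)

lemma Omega_r_eq_box:
  assumes "\<gamma> > 0"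
  shows "(Omega_r \<gamma> L r :: (real^('n::{finite,linorder})) set) =
    box (\<chi> i. - ((L + r) * \<gamma> ^ pos i)) (\<chi> i. (L + r) * \<gamma> ^ pos i)"
  unfolding set_eq_iff mem_Omega_r_iff[OF assms] mem_box_cart vec_lambda_beta abs_less_iff
  by (metis minus_less_iff)

lemma Omega_r_subset_Omega: "\<gamma> > 0 \<Longrightarrow> Omega_r \<gamma> L r \<subseteq> Omega \<gamma> (L + r)"
  by (auto simp: mem_Omega_iff mem_Omega_r_iff less_imp_le)

lemma Omega_subset_Omega_r:
  assumes "\<gamma> > 0" "M < L + r" shows "Omega \<gamma> M \<subseteq> Omega_r \<gamma> L r"
proof
  fix x assume "x \<in> Omega \<gamma> M"
  then have "\<bar>x $ i\<bar> < (L + r) * \<gamma> ^ pos i" for i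
    using assms mult_strict_right_mono[OF assms(2), of "\<gamma> ^ pos i"]
    by (auto simp: mem_Omega_iff intro: le_less_trans)
  then show "x \<in> Omega_r \<gamma> L r" using assms by (simp add: mem_Omega_r_iff)
qed

lemma nbhd_eq_UN_ball: "nbhd e X = (\<Union>x\<in>X. ball x e)"
  by (auto simp: nbhd_def dist_commute)

lemma open_nbhd: "open (nbhd e X)"
  by (auto simp: nbhd_eq_UN_ball)

lemma closure_subset_nbhd: "e > 0 \<Longrightarrow> closure X \<subseteq> nbhd e X"
  by (auto simp: nbhd_def closure_approachable dist_commute)

lemma negligible_coordinate_hyperplane: "negligible {x :: real^'n. x $ i = c}"
proof -
  have "axis i 1 \<noteq> (0 :: real^'n)" by (simp add: axis_eq_0_iff)
  then show ?thesis
    using negligible_hyperplane[of "axis i 1 :: real^'n" c] by (simp add: inner_axis')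
qed

lemma negligible_abs_coordinate: "negligible {x :: real^'n. \<bar>x $ i\<bar> = c}"
  by (rule negligible_subset[OF negligible_Un[OF negligible_coordinate_hyperplane[of i c]
        negligible_coordinate_hyperplane[of i "- c"]]]) auto

lemma C2_on_Smap:
  fixes \<Phi> :: "real^('n::{finite,linorder}) \<Rightarrow> real"
  assumes "C2_on (ocube (L + r)) \<Phi>"
  shows "C2_on (Omega_r \<gamma> L r) (Smap \<gamma> \<Phi>)"
proof -
  define A :: "(real, 'n) vec \<Rightarrow> (real, 'n) vec"
    where "A u = (\<chi> i. if pos i + 1 < CARD('n) then u $ crd (pos i + 1) / \<gamma> else 0)" for u
  define b :: "(real, 'n) vec"
    where "b = (\<chi> i. if pos i + 1 < CARD('n) then 0 else \<gamma> ^ (CARD('n) - 1))"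
  have "linear A" by (rule linearI) (auto simp: A_def vec_eq_iff add_divide_distrib)
  then have A: "C2_on (Omega_r \<gamma> L r) A"
    by (intro C2_on_bounded_linear) (simp add: linear_conv_bounded_linear)
  have "C2_on (Omega_r \<gamma> L r) (\<lambda>u. \<Phi> (Gam \<gamma> u) *\<^sub>R b)"
    by (rule C2_on_compose_bounded_linear[OF assms bounded_linear_scaleR_left])
       (auto simp: Omega_r_def linear_Gam simp flip: linear_conv_bounded_linear)
  from C2_on_add[OF A this] show ?thesis
    by (rule back_subst[of "C2_on _"]) (auto simp: A_def b_def Smap_def vec_eq_iff)
qed

locale expanding_branches =
  fixes \<Phi>0 :: "real^('n::{finite,linorder}) \<Rightarrow> real"
    and L \<beta> \<sigma> \<gamma> :: real
  assumes L: "L > 0" and \<beta>: "\<beta> > 0" and \<sigma>: "\<sigma> > 1" and \<gamma>: "\<gamma> > 0" "\<gamma> < 1"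
    and k2: "CARD('n) \<ge> 2"
    and C2_\<Phi>0: "C2_on (ocube (L + \<beta>)) \<Phi>0"
    and expanding_S: "expanding_on (sqrt \<sigma>) (Omega_r \<gamma> L \<beta>) (Smap \<gamma> \<Phi>0)"
begin

abbreviation S :: "(real, 'n) vec \<Rightarrow> (real, 'n) vec" where "S \<equiv> Smap \<gamma> \<Phi>0"
abbreviation T :: "real \<Rightarrow> int \<Rightarrow> (real, 'n) vec \<Rightarrow> (real, 'n) vec" where "T \<equiv> Tj \<gamma> L \<Phi>0"
abbreviation U :: "real \<Rightarrow> int \<Rightarrow> ((real, 'n) vec) set" where "U \<equiv> Uset \<gamma> L \<Phi>0"
abbreviation J :: "real \<Rightarrow> int set" where "J \<equiv> Jset \<gamma> L \<Phi>0"

definition margin :: real where "margin = \<gamma> ^ (CARD('n) - 1) * \<beta> / 2"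

abbreviation V :: "real \<Rightarrow> int \<Rightarrow> ((real, 'n) vec) set" where "V \<theta> \<equiv> Vset \<gamma> L \<Phi>0 \<theta> margin"
abbreviation inv_T :: "real \<Rightarrow> int \<Rightarrow> (real, 'n) vec \<Rightarrow> (real, 'n) vec" where
  "inv_T \<theta> j \<equiv> inv_into (V \<theta> j) (T \<theta> j)"

lemma margin_pos: "margin > 0"
  using \<gamma> \<beta> by (simp add: margin_def)

lemma power_last_le: "\<gamma> ^ (CARD('n) - 1) \<le> \<gamma> ^ pos (i :: 'n)"
  using pos_less[of i] \<gamma> by (intro power_decreasing) auto

lemma compact_convex_Omega:
  "compact (Omega \<gamma> M :: (real, 'n) vec set)" "convex (Omega \<gamma> M :: (real, 'n) vec set)"
  by (simp_all add: Omega_eq_cbox[OF \<gamma>(1)] compact_cbox)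

lemma
  shows Omega_subset_domain: "Omega \<gamma> L \<subseteq> Omega_r \<gamma> L \<beta>"
    and collar_subset_domain: "Omega \<gamma> (L + \<beta> / 2) \<subseteq> Omega_r \<gamma> L \<beta>"
    and interior_subset_Omega: "Omega_r \<gamma> L 0 \<subseteq> Omega \<gamma> L"
    and open_collar_subset_collar: "Omega_r \<gamma> L (\<beta> / 2) \<subseteq> Omega \<gamma> (L + \<beta> / 2)"
    and interior_subset_domain: "Omega_r \<gamma> L 0 \<subseteq> Omega_r \<gamma> L \<beta>"
    and open_collar_subset_domain: "Omega_r \<gamma> L (\<beta> / 2) \<subseteq> Omega_r \<gamma> L \<beta>"
  using Omega_subset_Omega_r[of \<gamma> L L \<beta>] Omega_subset_Omega_r[of \<gamma> "L + \<beta> / 2" L \<beta>]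
    Omega_r_subset_Omega[of \<gamma> L 0] Omega_r_subset_Omega[of \<gamma> L "\<beta> / 2"] \<gamma> \<beta> by auto

lemma T_eq_translate: "\<exists>v. T \<theta> j = (\<lambda>u. S u + v)"
  by (auto simp: fun_eq_iff Tj_def)

lemma C2_S: "C2_on (Omega_r \<gamma> L \<beta>) S"
  by (rule C2_on_Smap[OF C2_\<Phi>0])

lemma C2_T: "C2_on (Omega_r \<gamma> L \<beta>) (T \<theta> j)"
  using T_eq_translate[of \<theta> j] C2_on_add[OF C2_S C2_on_const] by auto

lemma continuous_on_T: "continuous_on (Omega_r \<gamma> L \<beta>) (T \<theta> j)"
  by (rule C2_on_imp_continuous_on[OF C2_T])

lemma dist_T: "dist (T \<theta> j u) (T \<theta> j v) = dist (S u) (S v)"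
  using T_eq_translate[of \<theta> j] by auto

lemma expanding_T: "expanding_on (sqrt \<sigma>) (Omega_r \<gamma> L \<beta>) (T \<theta> j)"
  using expanding_S by (simp add: expanding_on_def dist_T)

lemma inj_T: "inj_on (T \<theta> j) (Omega_r \<gamma> L \<beta>)"
  using expanding_on_imp_inj_on[OF expanding_T] \<sigma> by simp

lemma cball_margin_subset:
  fixes x :: "(real, 'n) vec"
  assumes x: "x \<in> Omega_r \<gamma> L 0"
  shows "cball x margin \<subseteq> Omega_r \<gamma> L (\<beta> / 2)"
proof
  fix y assume "y \<in> cball x margin"
  then have d: "norm (y - x) \<le> margin" by (simp add: dist_norm norm_minus_commute)
  have "\<bar>y $ i\<bar> < (L + \<beta> / 2) * \<gamma> ^ pos i" for i
  proof -
    have "margin \<le> \<beta> / 2 * \<gamma> ^ pos i"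
      using power_last_le[of i] \<beta> by (simp add: margin_def)
    moreover have "\<bar>y $ i - x $ i\<bar> \<le> norm (y - x)"
      using component_le_norm_cart[of "y - x" i] by simp
    moreover have "\<bar>x $ i\<bar> < L * \<gamma> ^ pos i" using x \<gamma> by (simp add: mem_Omega_r_iff)
    ultimately show ?thesis using d by (simp add: algebra_simps)
  qed
  then show "y \<in> Omega_r \<gamma> L (\<beta> / 2)" using \<gamma> by (simp add: mem_Omega_r_iff)
qed

lemma U_subset: "U \<theta> j \<subseteq> Omega_r \<gamma> L 0" "U \<theta> j \<subseteq> Omega \<gamma> L"
  using interior_subset_Omega by (auto simp: Uset_def)

lemma V_subset: "V \<theta> j \<subseteq> Omega_r \<gamma> L (\<beta> / 2)" "V \<theta> j \<subseteq> Omega_r \<gamma> L \<beta>"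
proof -
  have "ball x margin \<subseteq> Omega_r \<gamma> L (\<beta> / 2)" if "x \<in> U \<theta> j" for x
    using cball_margin_subset[OF subsetD[OF U_subset(1) that]] ball_subset_cball
    by (rule subset_trans[rotated])
  then show "V \<theta> j \<subseteq> Omega_r \<gamma> L (\<beta> / 2)"
    unfolding Vset_def nbhd_eq_UN_ball by (rule UN_least)
  then show "V \<theta> j \<subseteq> Omega_r \<gamma> L \<beta>" using open_collar_subset_domain by (rule subset_trans)
qed

lemma open_V: "open (V \<theta> j)"
  by (simp add: Vset_def open_nbhd)

lemma closure_U_subset_V: "closure (U \<theta> j) \<subseteq> V \<theta> j"
  unfolding Vset_def by (rule closure_subset_nbhd[OF margin_pos])

lemmas C2_T_V = C2_on_subset[OF C2_T V_subset(2)]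
lemmas expanding_T_V = expanding_on_subset[OF expanding_T V_subset(2)]

lemma C2_diffeo_T: "C2_diffeo_on (V \<theta> j) (T \<theta> j)"
  using C2_diffeo_on_expanding[OF C2_T_V expanding_T_V _ open_V] \<sigma> by simp

lemma Ttheta_eq_T:
  assumes u: "u \<in> U \<theta> j" shows "Ttheta \<gamma> L \<Phi>0 \<theta> u = T \<theta> j u"
proof -
  have "\<lfloor>(\<Phi>0 (Gam \<gamma> u) + \<theta> + L) / (2 * L)\<rfloor> = j"
  proof (rule floor_unique)
    show "of_int j \<le> (\<Phi>0 (Gam \<gamma> u) + \<theta> + L) / (2 * L)"
      using u L by (simp add: Uset_def pos_le_divide_eq algebra_simps)
    show "(\<Phi>0 (Gam \<gamma> u) + \<theta> + L) / (2 * L) < of_int j + 1"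
      using u L by (simp add: Uset_def pos_divide_less_eq algebra_simps)
  qed
  moreover have "pos i + 1 < CARD('n) \<longleftrightarrow> pos i + 1 \<noteq> CARD('n)" for i :: 'n
    using pos_less[of i] by auto
  ultimately show ?thesis
    unfolding Ttheta_def Tj_def Smap_def phi_red_def by (simp add: vec_eq_iff algebra_simps)
qed

lemma nbhd_Ttheta_image_subset: "nbhd (sqrt \<sigma> * margin) (Ttheta \<gamma> L \<Phi>0 \<theta> ` U \<theta> j) \<subseteq> T \<theta> j ` V \<theta> j"
proof -
  have "ball (T \<theta> j u) (sqrt \<sigma> * margin) \<subseteq> T \<theta> j ` V \<theta> j" if u: "u \<in> U \<theta> j" for u
  proof -
    have "cball u margin \<subseteq> Omega_r \<gamma> L \<beta>"
      using cball_margin_subset[OF subsetD[OF U_subset(1) u]] open_collar_subset_domain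
      by (rule subset_trans)
    then have "ball (T \<theta> j u) (sqrt \<sigma> * margin) \<subseteq> T \<theta> j ` ball u margin"
      using \<sigma> margin_pos
      by (intro ball_subset_image_expanding expanding_on_subset[OF expanding_T]
          continuous_on_subset[OF continuous_on_T]) auto
    also have "\<dots> \<subseteq> T \<theta> j ` V \<theta> j" using u by (auto simp: Vset_def nbhd_eq_UN_ball)
    finally show ?thesis .
  qed
  then show ?thesis by (auto simp: nbhd_eq_UN_ball Ttheta_eq_T)
qed

lemma inv_T_contraction:
  assumes "u \<in> T \<theta> j ` V \<theta> j" "v \<in> T \<theta> j ` V \<theta> j"
  shows "dist (inv_T \<theta> j u) (inv_T \<theta> j v) \<le> \<sigma> powr (-1/2) * dist u v"
  using lipschitz_onD[OF lipschitz_on_inv_into_expanding[OF expanding_T_V] assms]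
    powr_minus_half[of \<sigma>] \<sigma>
  by simp

lemma jac_det_T:
  assumes "u \<in> Omega_r \<gamma> L \<beta>" shows "jac_det (T \<theta> j) u = jac_det S u"
proof -
  obtain v where T: "T \<theta> j = (\<lambda>u. S u + v)" using T_eq_translate by blast
  obtain S' where S': "(S has_derivative S') (at u)"
    using C2_on_imp_differentiable[OF C2_S assms] by (auto simp: differentiable_def)
  then have "(T \<theta> j has_derivative S') (at u)" unfolding T by (auto intro!: derivative_eq_intros)
  then show ?thesis using S' by (simp add: jac_det_eq)
qed

lemma jac_det_inv_T:
  assumes "u \<in> V \<theta> j" shows "jac_det (inv_T \<theta> j) (T \<theta> j u) = 1 / jac_det S u"
  using jac_det_inv_into_expanding(2)[OF expanding_T_V _ open_V C2_T_V assms]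
    jac_det_T[OF subsetD[OF V_subset(2) assms]] \<sigma> by simp

lemma ex_bounded_distortion_reciprocal_jac_det:
  "\<exists>K>0. bounded_distortion_on K (Omega \<gamma> (L + \<beta> / 2)) (\<lambda>u. 1 / jac_det S u)"
proof -
  have "open (Omega_r \<gamma> L \<beta> :: (real, 'n) vec set)" by (simp add: Omega_r_eq_box[OF \<gamma>(1)] open_box)
  then have "jac_det S u \<noteq> 0" if "u \<in> Omega \<gamma> (L + \<beta> / 2)" for u
    using jac_det_inv_into_expanding(1)[OF expanding_S _ _ C2_S]
      subsetD[OF collar_subset_domain that] \<sigma> by simp
  moreover obtain M where "M-lipschitz_on (Omega \<gamma> (L + \<beta> / 2)) (jac_det S)"
    using C2_on_imp_lipschitz_on_jac_det[OF C2_S compact_convex_Omega collar_subset_domain] by blast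
  ultimately show ?thesis
    by (intro reciprocal_bounded_distortion_on_compact[OF compact_convex_Omega(1)])
qed

lemma ex_bounded_distortion_jac_det_inv_T:
  "\<exists>K>0. \<forall>\<theta> j. bounded_distortion_on K (T \<theta> j ` V \<theta> j) (jac_det (inv_T \<theta> j))"
proof -
  obtain K where K: "K > 0" "bounded_distortion_on K (Omega \<gamma> (L + \<beta> / 2)) (\<lambda>u. 1 / jac_det S u)"
    using ex_bounded_distortion_reciprocal_jac_det by blast
  have "bounded_distortion_on K (T \<theta> j ` V \<theta> j) (jac_det (inv_T \<theta> j))" for \<theta> j
    unfolding bounded_distortion_on_def ball_simps
  proof (intro ballI)
    fix u v w assume uvw: "u \<in> V \<theta> j" "v \<in> V \<theta> j" "w \<in> V \<theta> j"
    have "1 * dist u v \<le> sqrt \<sigma> * dist u v" using \<sigma> by (intro mult_right_mono) auto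
    also have "\<dots> \<le> dist (T \<theta> j u) (T \<theta> j v)" by (rule expanding_onD[OF expanding_T_V uvw(1,2)])
    finally have dist_le: "dist u v \<le> dist (T \<theta> j u) (T \<theta> j v)" by simp
    have "\<bar>1 / jac_det S u - 1 / jac_det S v\<bar> \<le> K * \<bar>1 / jac_det S w\<bar> * dist u v"
      using K(2) uvw V_subset(1) open_collar_subset_collar
      unfolding bounded_distortion_on_def by blast
    also have "\<dots> \<le> K * \<bar>1 / jac_det S w\<bar> * dist (T \<theta> j u) (T \<theta> j v)"
      using K(1) dist_le by (intro mult_left_mono) auto
    finally show "\<bar>jac_det (inv_T \<theta> j) (T \<theta> j u) - jac_det (inv_T \<theta> j) (T \<theta> j v)\<bar>
        \<le> K * \<bar>jac_det (inv_T \<theta> j) (T \<theta> j w)\<bar> * dist (T \<theta> j u) (T \<theta> j v)"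
      unfolding uvw[THEN jac_det_inv_T] .
  qed
  then show ?thesis using K(1) by blast
qed

subsection \<open>Branches in terms of the last coordinate\<close>

text \<open>The height is the last coordinate of the image before its reduction modulo \<open>2 * half_period\<close>.\<close>

definition half_period :: real where "half_period = \<gamma> ^ (CARD('n) - 1) * L"

definition height :: "real \<Rightarrow> (real, 'n) vec \<Rightarrow> real" where
  "height \<theta> u = \<gamma> ^ (CARD('n) - 1) * (\<theta> + \<Phi>0 (Gam \<gamma> u))"

lemma half_period_pos: "half_period > 0"
  using L \<gamma> by (simp add: half_period_def)

lemma half_period_le: "half_period \<le> L * \<gamma> ^ pos (i :: 'n)"
  using mult_left_mono[OF power_last_le[of i], of L] L by (simp add: half_period_def mult.commute)

lemma S_last: "S u $ crd (CARD('n) - 1) = \<gamma> ^ (CARD('n) - 1) * \<Phi>0 (Gam \<gamma> u)"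
  using k2 by (simp add: Smap_def pos_crd)

lemma height_eq: "height \<theta> u = S u $ crd (CARD('n) - 1) + \<gamma> ^ (CARD('n) - 1) * \<theta>"
  unfolding S_last by (simp add: height_def algebra_simps)

lemma height_diff_le: "\<bar>height \<theta> u - height \<theta> v\<bar> \<le> dist (S u) (S v)"
  using component_le_norm_cart[of "S u - S v" "crd (CARD('n) - 1)"]
  by (simp add: height_eq dist_norm del: One_nat_def)

lemma continuous_on_height: "continuous_on (Omega_r \<gamma> L \<beta>) (height \<theta>)"
  unfolding height_eq by (intro continuous_intros C2_on_imp_continuous_on[OF C2_S])

lemma mem_U_iff:
  "u \<in> U \<theta> j \<longleftrightarrow> u \<in> Omega_r \<gamma> L 0 \<and> \<bar>height \<theta> u - 2 * of_int j * half_period\<bar> < half_period"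
proof -
  define g where "g = \<gamma> ^ (CARD('n) - 1)"
  have g: "g > 0" using \<gamma> by (simp add: g_def)
  have "height \<theta> u - 2 * of_int j * half_period = g * (\<theta> + \<Phi>0 (Gam \<gamma> u) - 2 * of_int j * L)"
    by (simp add: height_def half_period_def g_def algebra_simps)
  then have "\<bar>height \<theta> u - 2 * of_int j * half_period\<bar> < half_period \<longleftrightarrow>
      g * \<bar>\<theta> + \<Phi>0 (Gam \<gamma> u) - 2 * of_int j * L\<bar> < g * L"
    using g by (simp only: abs_mult half_period_def g_def[symmetric] abs_of_pos)
  also have "\<dots> \<longleftrightarrow> \<bar>\<theta> + \<Phi>0 (Gam \<gamma> u) - 2 * of_int j * L\<bar> < L" using g by simp
  finally show ?thesis by (auto simp: Uset_def algebra_simps abs_less_iff)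
qed

lemma U_disjoint:
  assumes "i \<noteq> j" shows "U \<theta> i \<inter> U \<theta> j = {}"
proof (rule ccontr)
  assume "U \<theta> i \<inter> U \<theta> j \<noteq> {}"
  then obtain u where "\<bar>height \<theta> u - 2 * of_int i * half_period\<bar> < half_period"
      "\<bar>height \<theta> u - 2 * of_int j * half_period\<bar> < half_period"
    by (auto simp: mem_U_iff)
  then have "real_of_int (i - j) * (2 * half_period) < 1 * (2 * half_period)"
      "real_of_int (j - i) * (2 * half_period) < 1 * (2 * half_period)"
    by (simp_all add: abs_less_iff algebra_simps)
  then have "real_of_int (i - j) < 1" "real_of_int (j - i) < 1"
    using half_period_pos by (simp_all only: mult_less_cancel_right_pos)
  then show False using assms by linarith
qed

lemma bounded_height: "bounded (height \<theta> ` Omega \<gamma> L)"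
  by (intro compact_imp_bounded compact_continuous_image compact_convex_Omega
      continuous_on_subset[OF continuous_on_height Omega_subset_domain])

lemma finite_J: "finite (J \<theta>)"
proof -
  obtain B where B: "\<And>u. u \<in> Omega \<gamma> L \<Longrightarrow> \<bar>height \<theta> u\<bar> \<le> B"
    using bounded_height[of \<theta>] by (auto simp: bounded_iff)
  define N where "N = \<lceil>(B + half_period) / (2 * half_period)\<rceil>"
  have "J \<theta> \<subseteq> {- N..N}"
  proof
    fix j assume "j \<in> J \<theta>"
    then obtain u where u: "u \<in> U \<theta> j" by (auto simp: Jset_def)
    then have "\<bar>height \<theta> u - 2 * of_int j * half_period\<bar> < half_period" by (simp add: mem_U_iff)
    moreover have "\<bar>height \<theta> u\<bar> \<le> B" by (rule B[OF subsetD[OF U_subset(2) u]])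
    ultimately have "\<bar>2 * of_int j * half_period\<bar> \<le> B + half_period" by linarith
    then have "\<bar>real_of_int j\<bar> \<le> (B + half_period) / (2 * half_period)"
      using half_period_pos by (simp add: abs_mult pos_le_divide_eq mult_ac)
    then have "real_of_int \<bar>j\<bar> \<le> of_int N" unfolding N_def of_int_abs by linarith
    then show "j \<in> {- N..N}" unfolding of_int_le_iff by auto
  qed
  then show ?thesis by (rule finite_subset) simp
qed

lemma open_U: "open (U \<theta> j)"
proof -
  have "U \<theta> j = Omega_r \<gamma> L 0 \<inter> height \<theta> -` ball (2 * of_int j * half_period) half_period"
    by (auto simp: mem_U_iff dist_real_def abs_minus_commute)
  also have "open \<dots>"
    by (intro continuous_open_preimage open_ball
        continuous_on_subset[OF continuous_on_height interior_subset_domain])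
       (simp add: Omega_r_eq_box[OF \<gamma>(1)] open_box)
  finally show ?thesis .
qed

lemma closure_U_subset:
  "closure (U \<theta> j) \<subseteq> {u \<in> Omega \<gamma> L. \<bar>height \<theta> u - 2 * of_int j * half_period\<bar> \<le> half_period}"
  (is "_ \<subseteq> ?C")
proof (rule closure_minimal)
  show "U \<theta> j \<subseteq> ?C" using U_subset(2) by (auto simp: mem_U_iff)
  have "?C = Omega \<gamma> L \<inter> height \<theta> -` cball (2 * of_int j * half_period) half_period"
    by (auto simp: dist_real_def abs_minus_commute)
  also have "closed \<dots>"
    by (intro continuous_closed_preimage
        continuous_on_subset[OF continuous_on_height Omega_subset_domain]
        compact_imp_closed compact_convex_Omega closed_cball)
  finally show "closed ?C" .
qed

lemma frontier_U:
  assumes "u \<in> frontier (U \<theta> j)"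
  shows "u \<in> Omega \<gamma> L" "\<bar>height \<theta> u - 2 * of_int j * half_period\<bar> \<le> half_period"
    and "(\<exists>i. \<bar>u $ i\<bar> = L * \<gamma> ^ pos i) \<or> (\<exists>m::int. height \<theta> u = (2 * of_int m + 1) * half_period)"
proof -
  have u: "u \<in> closure (U \<theta> j)" "u \<notin> U \<theta> j"
    using assms open_U[of \<theta> j] by (auto simp: frontier_def interior_open)
  then show Omega: "u \<in> Omega \<gamma> L"
    and bound: "\<bar>height \<theta> u - 2 * of_int j * half_period\<bar> \<le> half_period"
    using closure_U_subset by auto
  consider (face) "u \<notin> Omega_r \<gamma> L 0"
    | (level) "\<bar>height \<theta> u - 2 * of_int j * half_period\<bar> = half_period"
    using u(2) bound by (auto simp: mem_U_iff)
  then show "(\<exists>i. \<bar>u $ i\<bar> = L * \<gamma> ^ pos i) \<or>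
      (\<exists>m::int. height \<theta> u = (2 * of_int m + 1) * half_period)"
  proof cases
    case face
    then have "\<exists>i. \<bar>u $ i\<bar> = L * \<gamma> ^ pos i"
      using Omega \<gamma> by (auto simp: mem_Omega_iff mem_Omega_r_iff not_less intro: antisym)
    then show ?thesis ..
  next
    case level
    then have "height \<theta> u = (2 * of_int j + 1) * half_period \<or>
        height \<theta> u = (2 * of_int (j - 1) + 1) * half_period"
      using half_period_pos by (auto simp: abs_if algebra_simps split: if_splits)
    then show ?thesis by blast
  qed
qed

lemma frontier_image_T: "frontier (T \<theta> j ` U \<theta> j) \<subseteq> T \<theta> j ` frontier (U \<theta> j)"
proof (rule frontier_injective_image_subset[OF open_U])
  have closure: "closure (U \<theta> j) \<subseteq> Omega_r \<gamma> L \<beta>"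
    using closure_U_subset Omega_subset_domain by blast
  show "bounded (U \<theta> j)"
    by (rule bounded_subset[OF compact_imp_bounded[OF compact_convex_Omega(1)] U_subset(2)])
  show "continuous_on (closure (U \<theta> j)) (T \<theta> j)"
    by (rule continuous_on_subset[OF continuous_on_T closure])
  show "inj_on (T \<theta> j) (U \<theta> j)"
    by (rule inj_on_subset[OF inj_T subset_trans[OF closure_subset closure]])
qed

subsection \<open>The discontinuity set is negligible\<close>

lemma negligible_level: "negligible {u \<in> Omega \<gamma> L. height \<theta> u = c}" (is "negligible ?A")
proof (rule negligible_expanding_image_imp[OF order_refl])
  show "expanding_on (sqrt \<sigma>) ?A S"
    by (rule expanding_on_subset[OF expanding_S]) (use Omega_subset_domain in blast)
  show "sqrt \<sigma> > 0" using \<sigma> by simp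
  have "S ` ?A \<subseteq> {y. y $ crd (CARD('n) - 1) = c - \<gamma> ^ (CARD('n) - 1) * \<theta>}"
    by (auto simp: height_eq simp del: One_nat_def)
  then show "negligible (S ` ?A)" by (rule negligible_subset[OF negligible_coordinate_hyperplane])
qed

lemma face_or_level_or_mem_U:
  assumes u: "u \<in> Omega \<gamma> L"
  shows "(\<exists>i. \<bar>u $ i\<bar> = L * \<gamma> ^ pos i) \<or>
    (\<exists>m::int. height \<theta> u = (2 * of_int m + 1) * half_period) \<or> (\<exists>j. u \<in> U \<theta> j)"
proof -
  define j where "j = \<lfloor>(height \<theta> u + half_period) / (2 * half_period)\<rfloor>"
  have "of_int j \<le> (height \<theta> u + half_period) / (2 * half_period)"
      "(height \<theta> u + half_period) / (2 * half_period) < of_int j + 1"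
    unfolding j_def by linarith+
  then have "2 * of_int j * half_period \<le> height \<theta> u + half_period"
      "height \<theta> u < 2 * of_int j * half_period + half_period"
    using half_period_pos by (simp_all add: pos_le_divide_eq pos_divide_less_eq algebra_simps)
  then consider (level) "height \<theta> u = (2 * of_int (j - 1) + 1) * half_period"
    | (branch) "\<bar>height \<theta> u - 2 * of_int j * half_period\<bar> < half_period"
    by (force simp: algebra_simps)
  then show ?thesis
  proof cases
    case branch
    then show ?thesis using u \<gamma> by (force simp: mem_U_iff mem_Omega_iff mem_Omega_r_iff less_le)
  qed blast
qed

lemma U_cover: "emeasure lebesgue (Omega \<gamma> L - (\<Union>j\<in>J \<theta>. U \<theta> j)) = 0"
proof -
  let ?faces = "\<Union>i. {u :: (real, 'n) vec. \<bar>u $ i\<bar> = L * \<gamma> ^ pos i}"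
  let ?levels = "\<Union>m::int. {u \<in> Omega \<gamma> L. height \<theta> u = (2 * of_int m + 1) * half_period}"
  have "negligible (?faces \<union> ?levels)"
    by (intro negligible_Un negligible_countable_Union)
       (auto intro!: negligible_abs_coordinate negligible_level)
  moreover have "Omega \<gamma> L - (\<Union>j\<in>J \<theta>. U \<theta> j) \<subseteq> ?faces \<union> ?levels"
  proof
    fix u assume u: "u \<in> Omega \<gamma> L - (\<Union>j\<in>J \<theta>. U \<theta> j)"
    then have "u \<notin> U \<theta> j" for j by (auto simp: Jset_def)
    then show "u \<in> ?faces \<union> ?levels" using face_or_level_or_mem_U[of u \<theta>] u by blast
  qed
  ultimately have "negligible (Omega \<gamma> L - (\<Union>j\<in>J \<theta>. U \<theta> j))" by (rule negligible_subset)
  then show ?thesis unfolding negligible_iff_null_sets by (rule null_setsD1)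
qed

subsection \<open>Overlap of the boundary neighbourhoods\<close>

definition boundary_nbhd :: "real \<Rightarrow> real \<Rightarrow> int \<Rightarrow> (real, 'n) vec set" where
  "boundary_nbhd \<theta> \<epsilon> j = {v \<in> V \<theta> j. T \<theta> j v \<in> nbhd \<epsilon> (frontier (T \<theta> j ` U \<theta> j))}"

definition level_nbhd :: "real \<Rightarrow> real \<Rightarrow> (real, 'n) vec set" where
  "level_nbhd \<theta> \<epsilon> = {p \<in> Omega_r \<gamma> L (\<beta> / 2).
      \<exists>m::int. \<bar>height \<theta> p - (2 * of_int m + 1) * half_period\<bar> < \<epsilon>}"

definition face_nbhd :: "real \<Rightarrow> 'n \<Rightarrow> (real, 'n) vec set" where
  "face_nbhd \<epsilon> i = {p. \<bar>\<bar>p $ i\<bar> - L * \<gamma> ^ pos i\<bar> \<le> \<epsilon> / sqrt \<sigma>}"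

lemma boundary_nbhd_near_frontier:
  assumes "p \<in> boundary_nbhd \<theta> \<epsilon> j"
  obtains q where "q \<in> frontier (U \<theta> j)" "dist p q \<le> \<epsilon> / sqrt \<sigma>" "\<bar>height \<theta> p - height \<theta> q\<bar> < \<epsilon>"
proof -
  obtain y where p: "p \<in> V \<theta> j" and y: "y \<in> frontier (T \<theta> j ` U \<theta> j)" "dist (T \<theta> j p) y < \<epsilon>"
    using assms by (auto simp: boundary_nbhd_def nbhd_def)
  obtain q where q: "q \<in> frontier (U \<theta> j)" "y = T \<theta> j q"
    using subsetD[OF frontier_image_T y(1)] by (elim imageE)
  have d: "dist (S p) (S q) < \<epsilon>" using y(2) q(2) by (simp add: dist_T)
  have "sqrt \<sigma> * dist p q \<le> dist (S p) (S q)"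
    using expanding_onD[OF expanding_S subsetD[OF V_subset(2) p]
      subsetD[OF Omega_subset_domain frontier_U(1)[OF q(1)]]] .
  then have "dist p q \<le> \<epsilon> / sqrt \<sigma>" using d \<sigma> by (simp add: pos_le_divide_eq mult.commute)
  moreover have "\<bar>height \<theta> p - height \<theta> q\<bar> < \<epsilon>" using height_diff_le d by (rule le_less_trans)
  ultimately show ?thesis using that q(1) by blast
qed

lemma boundary_nbhd_subset: "boundary_nbhd \<theta> \<epsilon> j \<subseteq> Omega_r \<gamma> L (\<beta> / 2)"
  using V_subset(1) by (auto simp: boundary_nbhd_def)

lemma boundary_nbhd_Int:
  assumes \<epsilon>: "\<epsilon> \<le> half_period" and p: "p \<in> boundary_nbhd \<theta> \<epsilon> i" "p \<in> boundary_nbhd \<theta> \<epsilon> j"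
    and "i < j"
  shows "p \<in> level_nbhd \<theta> \<epsilon>" "j \<le> i + 1"
proof -
  obtain q where q: "q \<in> frontier (U \<theta> i)" "\<bar>height \<theta> p - height \<theta> q\<bar> < \<epsilon>"
    using boundary_nbhd_near_frontier[OF p(1)] by metis
  obtain r where r: "r \<in> frontier (U \<theta> j)" "\<bar>height \<theta> p - height \<theta> r\<bar> < \<epsilon>"
    using boundary_nbhd_near_frontier[OF p(2)] by metis
  have heights: "height \<theta> p < (2 * of_int i + 1) * half_period + \<epsilon>"
    "(2 * of_int j - 1) * half_period - \<epsilon> < height \<theta> p"
    using frontier_U(2)[OF q(1)] frontier_U(2)[OF r(1)] q(2) r(2)
    by (simp_all add: algebra_simps abs_le_iff abs_less_iff)
  have "(2 * of_int i + 1) * half_period \<le> (2 * of_int j - 1) * half_period"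
    using half_period_pos \<open>i < j\<close> by (intro mult_right_mono) auto
  then have "\<bar>height \<theta> p - (2 * of_int i + 1) * half_period\<bar> < \<epsilon>" using heights by linarith
  then show "p \<in> level_nbhd \<theta> \<epsilon>" using p(1) boundary_nbhd_subset unfolding level_nbhd_def by blast
  show "j \<le> i + 1"
  proof (rule ccontr)
    assume "\<not> j \<le> i + 1"
    then have "(2 * of_int i + 1 + 2) * half_period \<le> (2 * of_int j - 1) * half_period"
      using half_period_pos by (intro mult_right_mono) auto
    then show False using heights \<epsilon> by (simp add: algebra_simps)
  qed
qed

lemma boundary_nbhd_subset_level_Un_faces:
  "boundary_nbhd \<theta> \<epsilon> j \<subseteq> level_nbhd \<theta> \<epsilon> \<union> (\<Union>i. face_nbhd \<epsilon> i)"
proof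
  fix p assume p: "p \<in> boundary_nbhd \<theta> \<epsilon> j"
  then obtain q where q: "q \<in> frontier (U \<theta> j)" "dist p q \<le> \<epsilon> / sqrt \<sigma>"
    "\<bar>height \<theta> p - height \<theta> q\<bar> < \<epsilon>"
    using boundary_nbhd_near_frontier by blast
  from frontier_U(3)[OF q(1)] consider (face) i where "\<bar>q $ i\<bar> = L * \<gamma> ^ pos i"
    | (level) m :: int where "height \<theta> q = (2 * of_int m + 1) * half_period"
    by blast
  then show "p \<in> level_nbhd \<theta> \<epsilon> \<union> (\<Union>i. face_nbhd \<epsilon> i)"
  proof cases
    case face
    have "\<bar>\<bar>p $ i\<bar> - \<bar>q $ i\<bar>\<bar> \<le> \<bar>(p - q) $ i\<bar>" by simp
    also have "\<dots> \<le> dist p q" unfolding dist_norm by (rule component_le_norm_cart)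
    finally have "p \<in> face_nbhd \<epsilon> i" using face q(2) by (simp add: face_nbhd_def)
    then show ?thesis by blast
  next
    case level
    then show ?thesis using q(3) p boundary_nbhd_subset unfolding level_nbhd_def by auto
  qed
qed

lemma card_boundary_nbhd_le_2:
  assumes "\<epsilon> \<le> half_period" shows "card {j \<in> J \<theta>. p \<in> boundary_nbhd \<theta> \<epsilon> j} \<le> 2"
  using boundary_nbhd_Int(2)[OF assms] finite_J by (intro card_le_2_of_consecutive) auto

lemma card_boundary_nbhd_minus_level_le_1:
  assumes "\<epsilon> \<le> half_period"
  shows "card {j \<in> J \<theta>. p \<in> boundary_nbhd \<theta> \<epsilon> j - level_nbhd \<theta> \<epsilon>} \<le> 1"
proof -
  have "i = j" if "p \<in> boundary_nbhd \<theta> \<epsilon> i - level_nbhd \<theta> \<epsilon>"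
    "p \<in> boundary_nbhd \<theta> \<epsilon> j - level_nbhd \<theta> \<epsilon>" for i j
    using boundary_nbhd_Int(1)[OF assms, of p \<theta>] that by (cases i j rule: linorder_cases) auto
  then show ?thesis
    using finite_J by (subst card_le_Suc0_iff_eq[unfolded One_nat_def[symmetric]]) auto
qed

lemma open_level_nbhd: "open (level_nbhd \<theta> \<epsilon>)"
proof -
  have "level_nbhd \<theta> \<epsilon> = (\<Union>m::int. Omega_r \<gamma> L (\<beta> / 2) \<inter>
      height \<theta> -` ball ((2 * of_int m + 1) * half_period) \<epsilon>)"
    by (auto simp: level_nbhd_def dist_real_def abs_minus_commute)
  also have "open \<dots>"
    by (intro open_UN ballI continuous_open_preimage
        continuous_on_subset[OF continuous_on_height open_collar_subset_domain] open_ball)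
       (simp add: Omega_r_eq_box[OF \<gamma>(1)] open_box)
  finally show ?thesis .
qed

lemma closed_face_nbhd: "closed (face_nbhd \<epsilon> i)"
  unfolding face_nbhd_def by (intro closed_Collect_le continuous_intros)

lemma open_boundary_nbhd: "open (boundary_nbhd \<theta> \<epsilon> j)"
proof -
  have "boundary_nbhd \<theta> \<epsilon> j = V \<theta> j \<inter> T \<theta> j -` nbhd \<epsilon> (frontier (T \<theta> j ` U \<theta> j))"
    by (auto simp: boundary_nbhd_def)
  also have "open \<dots>"
    by (intro continuous_open_preimage open_V open_nbhd
        continuous_on_subset[OF continuous_on_T V_subset(2)])
  finally show ?thesis .
qed

lemma sum_measure_boundary_nbhd_le:
  assumes \<epsilon>: "\<epsilon> \<le> half_period"
    and w: "measure lebesgue (level_nbhd \<theta> \<epsilon> \<inter> ball x R) \<le> w"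
      "\<And>i. measure lebesgue (face_nbhd \<epsilon> i \<inter> ball x R) \<le> w"
  shows "(\<Sum>j\<in>J \<theta>. measure lebesgue (boundary_nbhd \<theta> \<epsilon> j \<inter> ball x R)) \<le> (real CARD('n) + 2) * w"
proof -
  let ?level = "level_nbhd \<theta> \<epsilon> \<inter> ball x R" and ?faces = "\<Union>i. face_nbhd \<epsilon> i \<inter> ball x R"
  let ?A = "\<lambda>j. boundary_nbhd \<theta> \<epsilon> j \<inter> ball x R"
  have "X \<inter> ball x R \<in> lmeasurable" if "X \<in> sets borel" for X
    using that by (intro bounded_set_imp_lmeasurable bounded_Int) auto
  then have A: "?A j \<in> lmeasurable" and level: "?level \<in> lmeasurable"
    and face: "face_nbhd \<epsilon> i \<inter> ball x R \<in> lmeasurable" for i j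
    by (simp_all only: borel_open borel_closed open_boundary_nbhd open_level_nbhd closed_face_nbhd)
  have "measure lebesgue ?faces \<le> (\<Sum>i\<in>UNIV. measure lebesgue (face_nbhd \<epsilon> i \<inter> ball x R))"
    by (rule measure_UNION_le) (use face in auto)
  also have "\<dots> \<le> (\<Sum>i\<in>(UNIV :: 'n set). w)" by (intro sum_mono w(2))
  finally have faces_le: "measure lebesgue ?faces \<le> real CARD('n) * w" by simp
  have "(\<Sum>j\<in>J \<theta>. measure lebesgue (?A j)) \<le> real 2 * measure lebesgue ?level
      + real 1 * measure lebesgue ?faces"
  proof (rule sum_measure_le_of_overlap[OF finite_J A level])
    show "?faces \<in> lmeasurable" using face by (intro fmeasurable.finite_UN) simp_all
    show "?A j \<subseteq> ?level \<union> ?faces" for j using boundary_nbhd_subset_level_Un_faces[of \<theta> \<epsilon> j] by auto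
    show "card {j \<in> J \<theta>. p \<in> ?A j} \<le> 2" for p
      by (rule order_trans[OF card_mono card_boundary_nbhd_le_2[OF \<epsilon>]]) (use finite_J in auto)
    show "card {j \<in> J \<theta>. p \<in> ?A j - ?level} \<le> 1" for p
      by (rule order_trans[OF card_mono card_boundary_nbhd_minus_level_le_1[OF \<epsilon>]])
          (use finite_J in auto)
  qed
  also have "\<dots> \<le> 2 * w + real CARD('n) * w" using w(1) faces_le by simp
  finally show ?thesis by (simp add: algebra_simps)
qed

subsection \<open>Boundary neighbourhoods in small balls\<close>

text \<open>At a small scale a ball meets at most one of two opposite faces and at most one level.\<close>

definition small_scale :: "real \<Rightarrow> bool" where
  "small_scale \<delta> \<longleftrightarrow> 0 < \<delta> \<and> 2 * \<delta> \<le> half_period \<and>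
    (\<forall>\<theta>. \<forall>p\<in>Omega \<gamma> (L + \<beta> / 2). \<forall>q\<in>Omega \<gamma> (L + \<beta> / 2). dist p q < 2 * \<delta> \<longrightarrow>
      \<bar>height \<theta> p - height \<theta> q\<bar> < half_period)"

definition slab_volume :: "real \<Rightarrow> real \<Rightarrow> real" where
  "slab_volume \<epsilon> R = 2 * \<epsilon> / sqrt \<sigma> * (unit_ball_vol (real CARD('n) - 1) * R ^ (CARD('n) - 1))"

lemma small_scale_antimono: "small_scale \<delta> \<Longrightarrow> 0 < \<delta>' \<Longrightarrow> \<delta>' \<le> \<delta> \<Longrightarrow> small_scale \<delta>'"
  unfolding small_scale_def by fastforce

lemma ex_small_scale: "\<exists>\<delta>. small_scale \<delta>"
proof -
  have "uniformly_continuous_on (Omega \<gamma> (L + \<beta> / 2)) (height 0)"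
    by (intro compact_uniformly_continuous compact_convex_Omega
        continuous_on_subset[OF continuous_on_height collar_subset_domain])
  then obtain d where d: "d > 0"
    "\<And>p q. p \<in> Omega \<gamma> (L + \<beta> / 2) \<Longrightarrow> q \<in> Omega \<gamma> (L + \<beta> / 2) \<Longrightarrow> dist q p < d \<Longrightarrow>
      \<bar>height 0 q - height 0 p\<bar> < half_period"
    using half_period_pos unfolding uniformly_continuous_on_def dist_real_def by metis
  have "\<bar>height \<theta> p - height \<theta> q\<bar> < half_period"
    if "p \<in> Omega \<gamma> (L + \<beta> / 2)" "q \<in> Omega \<gamma> (L + \<beta> / 2)" "dist p q < d" for \<theta> p q
    using d(2)[OF that(2,1,3)] by (simp add: height_eq)
  then have "small_scale (min (d / 2) (half_period / 2))"
    using d(1) half_period_pos by (auto simp: small_scale_def)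
  then show ?thesis ..
qed

lemma dist_less_of_mem_ball: "p \<in> ball x R \<Longrightarrow> q \<in> ball x R \<Longrightarrow> dist p q < 2 * R"
  using dist_triangle3[of p q x] by simp

lemma face_nbhd_thin:
  assumes small: "small_scale \<delta>" and R: "R \<le> \<delta>" and \<epsilon>: "0 < \<epsilon>" "\<epsilon> \<le> \<delta>"
    and p: "p \<in> face_nbhd \<epsilon> i \<inter> ball x R" "p + t *\<^sub>R axis i 1 \<in> face_nbhd \<epsilon> i \<inter> ball x R"
  shows "\<bar>t\<bar> \<le> 2 * \<epsilon> / sqrt \<sigma>"
proof -
  define a where "a = \<epsilon> / sqrt \<sigma>"
  have "dist p (p + t *\<^sub>R axis i 1) < 2 * R" using p dist_less_of_mem_ball by blast
  then have "\<bar>t\<bar> < 2 * \<delta>" using R by (simp add: dist_norm)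
  moreover have "\<bar>\<bar>p $ i\<bar> - L * \<gamma> ^ pos i\<bar> \<le> a" "\<bar>\<bar>p $ i + t\<bar> - L * \<gamma> ^ pos i\<bar> \<le> a"
    using p by (auto simp: face_nbhd_def a_def)
  moreover have "a < \<epsilon>" using \<epsilon> \<sigma> by (simp add: a_def pos_divide_less_eq)
  moreover have "2 * \<delta> \<le> L * \<gamma> ^ pos i"
    using small half_period_le[of i] by (simp add: small_scale_def)
  ultimately have "\<bar>t\<bar> \<le> 2 * a" using \<epsilon>(2) by linarith
  then show ?thesis by (simp add: a_def)
qed

text \<open>Moving in the first coordinate changes only the last coordinate of \<open>S\<close>, so the
  expansion of \<open>S\<close> becomes a lower bound for the change of height.\<close>

lemma height_expanding_first_coordinate:
  assumes p: "p \<in> Omega_r \<gamma> L \<beta>" "p + t *\<^sub>R axis (crd 0) 1 \<in> Omega_r \<gamma> L \<beta>"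
  shows "sqrt \<sigma> * \<bar>t\<bar> \<le> \<bar>height \<theta> (p + t *\<^sub>R axis (crd 0) 1) - height \<theta> p\<bar>"
proof -
  let ?q = "p + t *\<^sub>R axis (crd 0) 1"
  have "(S ?q - S p) $ i = (height \<theta> ?q - height \<theta> p) * axis (crd (CARD('n) - 1)) 1 $ i" for i :: 'n
  proof (cases "pos i + 1 < CARD('n)")
    case True
    then have "i \<noteq> crd (CARD('n) - 1)" "crd (pos i + 1) \<noteq> (crd 0 :: 'n)"
      using pos_crd[where 'n='n, of "CARD('n) - 1"] pos_crd[where 'n='n, of "pos i + 1"]
        pos_crd[where 'n='n, of 0] by auto
    then show ?thesis using True by (simp add: Smap_def axis_def)
  next
    case False
    then have "pos i = CARD('n) - 1" using pos_less[of i] by simp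
    then have "i = crd (CARD('n) - 1)" by (metis crd_pos)
    then show ?thesis by (simp add: height_eq del: One_nat_def)
  qed
  then have "S ?q - S p = (height \<theta> ?q - height \<theta> p) *\<^sub>R axis (crd (CARD('n) - 1)) 1"
    unfolding vec_eq_iff vector_scaleR_component real_scaleR_def by blast
  then have "dist (S ?q) (S p) = \<bar>height \<theta> ?q - height \<theta> p\<bar>" by (simp add: dist_norm)
  moreover have "dist ?q p = \<bar>t\<bar>" by (simp add: dist_norm)
  ultimately show ?thesis using expanding_onD[OF expanding_S p(2,1)] by simp
qed

lemma level_nbhd_thin:
  assumes small: "small_scale \<delta>" and R: "R \<le> \<delta>" and \<epsilon>: "\<epsilon> \<le> \<delta>"
    and p: "p \<in> level_nbhd \<theta> \<epsilon> \<inter> ball x R" "p + t *\<^sub>R axis (crd 0) 1 \<in> level_nbhd \<theta> \<epsilon> \<inter> ball x R"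
  shows "\<bar>t\<bar> \<le> 2 * \<epsilon> / sqrt \<sigma>"
proof -
  let ?q = "p + t *\<^sub>R axis (crd 0) 1"
  obtain l m :: int where level: "\<bar>height \<theta> p - (2 * of_int l + 1) * half_period\<bar> < \<epsilon>"
    "\<bar>height \<theta> ?q - (2 * of_int m + 1) * half_period\<bar> < \<epsilon>"
    using p by (auto simp: level_nbhd_def)
  have pq: "p \<in> Omega_r \<gamma> L (\<beta> / 2)" "?q \<in> Omega_r \<gamma> L (\<beta> / 2)"
    using p by (auto simp: level_nbhd_def)
  have "dist p ?q < 2 * R" using p dist_less_of_mem_ball by blast
  then have "\<bar>height \<theta> p - height \<theta> ?q\<bar> < half_period"
    using small R pq[THEN subsetD[OF open_collar_subset_collar]] by (auto simp: small_scale_def)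
  moreover have "2 * \<epsilon> \<le> half_period" using small \<epsilon> by (simp add: small_scale_def)
  ultimately have "\<bar>2 * half_period * real_of_int (l - m)\<bar> < 2 * half_period"
    using level by (simp add: algebra_simps)
  then have "l = m" using half_period_pos by (simp add: abs_mult)
  then have "\<bar>height \<theta> ?q - height \<theta> p\<bar> < 2 * \<epsilon>" using level by auto
  moreover have "sqrt \<sigma> * \<bar>t\<bar> \<le> \<bar>height \<theta> ?q - height \<theta> p\<bar>"
    using pq open_collar_subset_domain by (intro height_expanding_first_coordinate) auto
  ultimately show ?thesis using \<sigma> by (simp add: pos_le_divide_eq mult.commute)
qed

lemma measure_face_nbhd_le:
  assumes "small_scale \<delta>" "0 < R" "R \<le> \<delta>" "0 < \<epsilon>" "\<epsilon> \<le> \<delta>"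
  shows "measure lebesgue (face_nbhd \<epsilon> i \<inter> ball x R) \<le> slab_volume \<epsilon> R"
proof -
  have "face_nbhd \<epsilon> i \<inter> ball x R \<in> sets borel"
    by (intro sets.Int borel_closed[OF closed_face_nbhd] borel_open[OF open_ball])
  then show ?thesis
    using measure_le_of_thin_slices[of "face_nbhd \<epsilon> i \<inter> ball x R" x R "axis i 1" "2 * \<epsilon> / sqrt \<sigma>"]
      face_nbhd_thin[OF assms(1,3-5)] assms \<sigma> by (simp add: slab_volume_def)
qed

lemma measure_level_nbhd_le:
  assumes "small_scale \<delta>" "0 < R" "R \<le> \<delta>" "0 < \<epsilon>" "\<epsilon> \<le> \<delta>"
  shows "measure lebesgue (level_nbhd \<theta> \<epsilon> \<inter> ball x R) \<le> slab_volume \<epsilon> R"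
proof -
  have "level_nbhd \<theta> \<epsilon> \<inter> ball x R \<in> sets borel"
    by (intro borel_open open_Int open_level_nbhd open_ball)
  then show ?thesis
    using measure_le_of_thin_slices[of "level_nbhd \<theta> \<epsilon> \<inter> ball x R" x R "axis (crd 0) 1"
      "2 * \<epsilon> / sqrt \<sigma>"]
      level_nbhd_thin[OF assms(1,3,5)] assms \<sigma> by (simp add: slab_volume_def)
qed

subsection \<open>The bound on \<open>\<eta>\<close>\<close>

definition eta_bound :: real where "eta_bound = eta0 CARD('n) \<sigma> (real CARD('n) + 2)"

lemma Gx_le:
  assumes small: "small_scale \<delta>" and \<epsilon>: "0 < \<epsilon>" "\<epsilon> \<le> \<delta>"
  shows "Gx \<gamma> L \<Phi>0 \<theta> \<sigma> margin x \<epsilon> \<delta> \<le> (eta_bound - \<sigma> powr (-1/2)) / 2 / \<delta> * \<epsilon>"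
proof -
  define s where "s = \<sigma> powr (-1/2)"
  have s: "s = 1 / sqrt \<sigma>" "0 < s" "s < 1" using \<sigma> powr_minus_half[of \<sigma>] by (simp_all add: s_def)
  define R where "R = (1 - s) * \<delta>"
  have R: "R > 0" "R \<le> \<delta>" using s \<epsilon> by (simp_all add: R_def mult_left_le_one_le)
  define P where "P = R ^ (CARD('n) - 1)"
  have P: "P > 0" using R by (simp add: P_def)
  let ?k = "real CARD('n)" and ?B = "ball x R"
  have ball_volume: "measure lebesgue ?B = unit_ball_vol ?k * (R * P)"
    using content_ball[of R x] R(1) power_minus_mult[of "CARD('n)" R]
    by (simp add: P_def mult.commute)
  have slab: "slab_volume \<epsilon> R = 2 * \<epsilon> * s * (unit_ball_vol (?k - 1) * P)"
    by (simp add: slab_volume_def s(1) P_def)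
  have "Gx \<gamma> L \<Phi>0 \<theta> \<sigma> margin x \<epsilon> \<delta> =
      (\<Sum>j\<in>J \<theta>. measure lebesgue (boundary_nbhd \<theta> \<epsilon> j \<inter> ?B)) / measure lebesgue ?B"
    unfolding Gx_def boundary_nbhd_def R_def s_def by (simp add: sum_divide_distrib)
  also have "\<dots> \<le> (?k + 2) * slab_volume \<epsilon> R / measure lebesgue ?B"
    using small \<epsilon> measure_level_nbhd_le[OF small R \<epsilon>] measure_face_nbhd_le[OF small R \<epsilon>]
    by (intro divide_right_mono sum_measure_boundary_nbhd_le) (auto simp: small_scale_def)
  also have "\<dots> = (?k + 2) * (2 * s) * (unit_ball_vol (?k - 1) / unit_ball_vol ?k) / (1 - s) / \<delta> * \<epsilon>"
    unfolding ball_volume slab using P by (simp add: R_def mult_ac)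
  also have "\<dots> = (eta_bound - s) / 2 / \<delta> * \<epsilon>"
  proof -
    have "4 / (sqrt \<sigma> - 1) = 4 * s / (1 - s)" using \<sigma> by (simp add: s(1) field_simps)
    then have eta_bound: "eta_bound - s = 4 * s / (1 - s) * (?k + 2) *
        (unit_ball_vol (?k - 1) / unit_ball_vol ?k)"
      unfolding eta_bound_def eta0_def s_def[symmetric] by simp
    have "4 * s / t * a * r / 2 = a * (2 * s) * r / t" for a r t by simp
    then show ?thesis unfolding eta_bound by (simp only:)
  qed
  finally show ?thesis by (simp only: s_def)
qed

lemma eta_le:
  assumes small: "small_scale \<delta>"
  shows "eta \<gamma> L \<Phi>0 \<theta> \<sigma> margin \<delta> \<le> ereal eta_bound"
proof -
  define s D where "s = \<sigma> powr (-1/2)" and "D = (eta_bound - s) / 2"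
  have \<delta>: "\<delta> > 0" using small by (simp add: small_scale_def)
  have "Gsup \<gamma> L \<Phi>0 \<theta> \<sigma> margin \<epsilon> \<delta> / ereal \<epsilon> \<le> ereal (D / \<delta>)" if \<epsilon>: "\<epsilon> \<in> {0<..\<delta>}" for \<epsilon>
  proof -
    have "Gsup \<gamma> L \<Phi>0 \<theta> \<sigma> margin \<epsilon> \<delta> \<le> ereal (D / \<delta> * \<epsilon>)"
      unfolding Gsup_def D_def s_def using Gx_le[OF small] \<epsilon> by (intro SUP_least) auto
    then have "Gsup \<gamma> L \<Phi>0 \<theta> \<sigma> margin \<epsilon> \<delta> / ereal \<epsilon> \<le> ereal (D / \<delta> * \<epsilon>) / ereal \<epsilon>"
      using \<epsilon> by (intro ereal_divide_right_mono) auto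
    then show ?thesis using \<epsilon> by simp
  qed
  then have "(SUP \<epsilon>\<in>{0<..\<delta>}. Gsup \<gamma> L \<Phi>0 \<theta> \<sigma> margin \<epsilon> \<delta> / ereal \<epsilon>) \<le> ereal (D / \<delta>)"
    by (rule SUP_least)
  then have "2 * (SUP \<epsilon>\<in>{0<..\<delta>}. Gsup \<gamma> L \<Phi>0 \<theta> \<sigma> margin \<epsilon> \<delta> / ereal \<epsilon>) * ereal \<delta>
      \<le> 2 * ereal (D / \<delta>) * ereal \<delta>"
    using \<delta> by (intro ereal_mult_right_mono ereal_mult_left_mono) auto
  also have "\<dots> = ereal (eta_bound - s)"
    using \<delta> by (simp only: numeral_eq_ereal times_ereal.simps) (simp add: D_def)
  finally have "eta \<gamma> L \<Phi>0 \<theta> \<sigma> margin \<delta> \<le> ereal s + ereal (eta_bound - s)"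
    unfolding eta_def s_def by (rule add_left_mono)
  then show ?thesis by simp
qed

theorem ex_SUP_eta_less_1:
  assumes "eta_bound < 1"
  obtains \<epsilon>0 where "\<epsilon>0 > 0" "\<And>\<theta>. (SUP \<delta>\<in>{0<..\<epsilon>0}. eta \<gamma> L \<Phi>0 \<theta> \<sigma> margin \<delta>) < 1"
proof -
  obtain \<epsilon>0 where small: "small_scale \<epsilon>0" using ex_small_scale by blast
  have "(SUP \<delta>\<in>{0<..\<epsilon>0}. eta \<gamma> L \<Phi>0 \<theta> \<sigma> margin \<delta>) \<le> ereal eta_bound" for \<theta>
    using small_scale_antimono[OF small] by (intro SUP_least eta_le) auto
  then have "(SUP \<delta>\<in>{0<..\<epsilon>0}. eta \<gamma> L \<Phi>0 \<theta> \<sigma> margin \<delta>) < 1" for \<theta>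
    by (rule le_less_trans) (use assms in simp)
  then show ?thesis using that small by (auto simp: small_scale_def)
qed

end

theorem theorem2p1:
  fixes \<Phi>0 :: "real^('n::{finite,linorder}) \<Rightarrow> real"
    and L \<beta> \<sigma> C1 C2 \<gamma> :: real
  assumes k2: "CARD('n) \<ge> 2"
    and L: "L > 0" and \<beta>: "\<beta> > 0"
    and C2Phi: "C2_on (ocube (L + \<beta>)) \<Phi>0"
    and sigma: "\<sigma> > Sk CARD('n) (real CARD('n) + 2)"
    and C1: "C1 > 1" and C2: "C2 > 1"
    and gam: "\<gamma> > 0" "1 / \<gamma>^2 = C1 * \<sigma>"
    and d1: "\<forall>x\<in>ocube (L + \<beta>). (partial \<Phi>0 0 x)^2 \<ge> C1 ^ (CARD('n) - 1) * C2 * \<sigma> ^ CARD('n)"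
    and dj: "\<forall>x\<in>ocube (L + \<beta>). \<forall>p. 1 \<le> p \<and> p < CARD('n) \<longrightarrow>
               (partial \<Phi>0 p x)^2 \<le> (C1 - 1) * (C2 - 1) / (real CARD('n) - 1) * \<sigma>"
  shows "\<exists>r0 \<epsilon>m K \<epsilon>0. r0 > 0 \<and> \<epsilon>m > 0 \<and> K > 0 \<and> \<epsilon>0 > 0 \<and>
    (\<forall>\<theta>.
      finite (Jset \<gamma> L \<Phi>0 \<theta>) \<and>
      \<comment> \<open>(PRE)\<close>
      (\<forall>i\<in>Jset \<gamma> L \<Phi>0 \<theta>. \<forall>j\<in>Jset \<gamma> L \<Phi>0 \<theta>. i \<noteq> j \<longrightarrow>
          Uset \<gamma> L \<Phi>0 \<theta> i \<inter> Uset \<gamma> L \<Phi>0 \<theta> j = {}) \<and>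
      (\<forall>j\<in>Jset \<gamma> L \<Phi>0 \<theta>.
         open (Uset \<gamma> L \<Phi>0 \<theta> j) \<and> Uset \<gamma> L \<Phi>0 \<theta> j \<subseteq> Omega \<gamma> L \<and>
         closure (Uset \<gamma> L \<Phi>0 \<theta> j) \<subseteq> Vset \<gamma> L \<Phi>0 \<theta> \<epsilon>m j \<and>
         Vset \<gamma> L \<Phi>0 \<theta> \<epsilon>m j \<subseteq> Omega_r \<gamma> L \<beta> \<and>
         C2_on (Vset \<gamma> L \<Phi>0 \<theta> \<epsilon>m j) (Tj \<gamma> L \<Phi>0 \<theta> j) \<and>
      \<comment> \<open>(PE1)\<close>
         (\<forall>u\<in>Uset \<gamma> L \<Phi>0 \<theta> j. Ttheta \<gamma> L \<Phi>0 \<theta> u = Tj \<gamma> L \<Phi>0 \<theta> j u) \<and>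
         nbhd r0 (Ttheta \<gamma> L \<Phi>0 \<theta> ` Uset \<gamma> L \<Phi>0 \<theta> j)
           \<subseteq> Tj \<gamma> L \<Phi>0 \<theta> j ` Vset \<gamma> L \<Phi>0 \<theta> \<epsilon>m j \<and>
      \<comment> \<open>(PE2)\<close>
         C2_diffeo_on (Vset \<gamma> L \<Phi>0 \<theta> \<epsilon>m j) (Tj \<gamma> L \<Phi>0 \<theta> j) \<and>
         (\<forall>\<epsilon>. 0 < \<epsilon> \<and> \<epsilon> < \<epsilon>0 \<longrightarrow>
            (\<forall>z\<in>Tj \<gamma> L \<Phi>0 \<theta> j ` Vset \<gamma> L \<Phi>0 \<theta> \<epsilon>m j.
             \<forall>x\<in>ball z \<epsilon> \<inter> Tj \<gamma> L \<Phi>0 \<theta> j ` Vset \<gamma> L \<Phi>0 \<theta> \<epsilon>m j.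
             \<forall>y\<in>ball z \<epsilon> \<inter> Tj \<gamma> L \<Phi>0 \<theta> j ` Vset \<gamma> L \<Phi>0 \<theta> \<epsilon>m j.
               \<bar>jac_det (inv_into (Vset \<gamma> L \<Phi>0 \<theta> \<epsilon>m j) (Tj \<gamma> L \<Phi>0 \<theta> j)) x
                - jac_det (inv_into (Vset \<gamma> L \<Phi>0 \<theta> \<epsilon>m j) (Tj \<gamma> L \<Phi>0 \<theta> j)) y\<bar>
               \<le> K * \<bar>jac_det (inv_into (Vset \<gamma> L \<Phi>0 \<theta> \<epsilon>m j) (Tj \<gamma> L \<Phi>0 \<theta> j)) z\<bar> * \<epsilon>)) \<and>
      \<comment> \<open>(PE4)\<close>
         (\<forall>u\<in>Tj \<gamma> L \<Phi>0 \<theta> j ` Vset \<gamma> L \<Phi>0 \<theta> \<epsilon>m j.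
          \<forall>v\<in>Tj \<gamma> L \<Phi>0 \<theta> j ` Vset \<gamma> L \<Phi>0 \<theta> \<epsilon>m j.
            dist u v \<le> \<epsilon>0 \<longrightarrow>
            dist (inv_into (Vset \<gamma> L \<Phi>0 \<theta> \<epsilon>m j) (Tj \<gamma> L \<Phi>0 \<theta> j) u)
                 (inv_into (Vset \<gamma> L \<Phi>0 \<theta> \<epsilon>m j) (Tj \<gamma> L \<Phi>0 \<theta> j) v)
              \<le> \<sigma> powr (-1/2) * dist u v)) \<and>
      \<comment> \<open>(PE3)\<close>
      emeasure lebesgue (Omega \<gamma> L - (\<Union>j\<in>Jset \<gamma> L \<Phi>0 \<theta>. Uset \<gamma> L \<Phi>0 \<theta> j)) = 0 \<and>
      \<comment> \<open>(PE5)\<close>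
      (SUP \<delta>\<in>{0<..\<epsilon>0}. eta \<gamma> L \<Phi>0 \<theta> \<sigma> \<epsilon>m \<delta>) < 1)"
proof -
  have \<sigma>: "\<sigma> > 1" and eta0: "eta0 CARD('n) \<sigma> (real CARD('n) + 2) < 1"
    using Sk_less_imp[of "CARD('n)" "real CARD('n) + 2" \<sigma>] k2 sigma by auto
  interpret steep: steep_potential \<Phi>0 "L + \<beta>" \<sigma> C1 C2 \<gamma>
    using k2 C2_on_imp_differentiable[OF C2Phi] \<sigma> C1 C2 gam d1 dj by unfold_locales auto
  interpret expanding_branches \<Phi>0 L \<beta> \<sigma> \<gamma>
    using L \<beta> \<sigma> gam(1) steep.\<gamma>_less_1 k2 C2Phi steep.expanding_on_Smap
    by unfold_locales (simp_all add: Omega_r_def)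
  obtain K where K: "K > 0" "\<And>\<theta> j. bounded_distortion_on K (T \<theta> j ` V \<theta> j) (jac_det (inv_T \<theta> j))"
    using ex_bounded_distortion_jac_det_inv_T by blast
  obtain \<epsilon>0 where \<epsilon>0: "\<epsilon>0 > 0" "\<And>\<theta>. (SUP \<delta>\<in>{0<..\<epsilon>0}. eta \<gamma> L \<Phi>0 \<theta> \<sigma> margin \<delta>) < 1"
    using ex_SUP_eta_less_1 eta0 by (auto simp: eta_bound_def)
  have "sqrt \<sigma> * margin > 0" "2 * K > 0" using \<sigma> margin_pos K(1) by simp_all
  then show ?thesis
    by (intro exI[of _ "sqrt \<sigma> * margin"] exI[of _ margin] exI[of _ "2 * K"] exI[of _ \<epsilon>0]
        conjI allI ballI impI)
      (assumption | rule margin_pos \<epsilon>0 finite_J U_disjoint U_cover open_U U_subset(2)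
        closure_U_subset_V V_subset(2) C2_T_V Ttheta_eq_T nbhd_Ttheta_image_subset
        C2_diffeo_T bounded_distortion_on_ballD[OF K(2,1)] inv_T_contraction)+
qed

end
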